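(* Let $M$ be a matroid of rank $r$ with a stressed hyperplane $H$, $|H|\ge r$, and let $\widetilde{M}$ be the relaxation of $M$ at $H$. Then: (1) if White's conjecture holds for $M$, then White's conjecture holds for $\widetilde{M}$; (2) if White's conjecture holds for $\widetilde{M}$ and the following condition ( * ) holds for $M$, then White's conjecture holds for $M$. Condition ( * ): for $n\in\{2,3\}$, any two $n$-tuples of bases of $M$ that are connected by an exchange sequence of length $2$ in $\widetilde{M}$ can be connected by an exchange sequence (of some length) in $M$.
   Context: Matroids are on finite ground sets. A hyperplane $H$ of a rank-$r$ matroid $M$ is stressed if every subset of $H$ of size $r$ is a circuit of $M$. If $H$ is a stressed hyperplane of $M$ and $\mathcal{B}$ is the set of bases of $M$, then $\mathcal{B}\cup\{S: S\subset H, |S|=r\}$ is the set of bases of a matroid $\widetilde{M}$ (a known theorem), called the relaxation of $M$ at $H$. Symmetric exchange: given bases $A,B$ of a matroid $N$, a pair $(A',B')$ is obtained from $(A,B)$ by a symmetric exchange (in $N$) if there are $a\in A\setminus B$ and $b\in B\setminus A$ with $A'=(A\cup\{b\})\setminus\{a\}$, $B'=(B\cup\{a\})\setminus\{b\}$, and $A',B'$ are both bases of $N$. Exchange sequence: an exchange sequence in $N$ of length $\ell\ge 0$ from $(B_1,\ldots,B_n)$ to $(B'_1,\ldots,B'_n)$ is a sequence $(B_1^{(0)},\ldots,B_n^{(0)})=(B_1,\ldots,B_n),\ldots,(B_1^{(\ell)},\ldots,B_n^{(\ell)})=(B'_1,\ldots,B'_n)$ of $n$-tuples of bases of $N$ such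 that for each $0<t\le\ell$ there are indices $i\ne j$ for which $(B_i^{(t)},B_j^{(t)})$ is obtained from $(B_i^{(t-1)},B_j^{(t-1)})$ by a symmetric exchange in $N$, and $B_k^{(t)}=B_k^{(t-1)}$ for all $k\neq i,j$. White's conjecture holds for a matroid $N$ if for every positive integer $n$ and every two ordered $n$-tuples of bases of $N$ with equal multi-set union, there is an exchange sequence in $N$ from one to the other. *)

theory Defs
  imports Main "HOL-Library.Multiset"
begin

text \<open>
  A matroid on a finite ground set, presented by its collection of bases.
\<close>

record 'a basis_system =
  ground :: "'a set"
  bases :: "'a set set"

definition matroid :: "'a basis_system \<Rightarrow> bool" where
  "matroid M \<longleftrightarrow>
     finite (ground M) \<and>
     bases M \<noteq> {} \<and>
     (\<forall>B\<in>bases M. B \<subseteq> ground M) \<and>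
     (\<forall>A\<in>bases M. \<forall>B\<in>bases M. \<forall>a\<in>A - B. \<exists>b\<in>B - A. (A - {a}) \<union> {b} \<in> bases M)"

definition indep :: "'a basis_system \<Rightarrow> 'a set \<Rightarrow> bool" where
  "indep M I \<longleftrightarrow> (\<exists>B\<in>bases M. I \<subseteq> B)"

definition circuit :: "'a basis_system \<Rightarrow> 'a set \<Rightarrow> bool" where
  "circuit M C \<longleftrightarrow> C \<subseteq> ground M \<and> \<not> indep M C \<and> (\<forall>D. D \<subset> C \<longrightarrow> indep M D)"

definition rank_of :: "'a basis_system \<Rightarrow> 'a set \<Rightarrow> nat" where
  "rank_of M X = Max (card ` {I. I \<subseteq> X \<and> indep M I})"

definition matroid_rank :: "'a basis_system \<Rightarrow> nat" where
  "matroid_rank M = rank_of M (ground M)"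

definition flat :: "'a basis_system \<Rightarrow> 'a set \<Rightarrow> bool" where
  "flat M F \<longleftrightarrow>
     F \<subseteq> ground M \<and> (\<forall>x\<in>ground M - F. rank_of M (insert x F) > rank_of M F)"

text \<open>
  The rank condition is written additively, so that a matroid of rank 0 has no hyperplane.
\<close>

definition hyperplane :: "'a basis_system \<Rightarrow> 'a set \<Rightarrow> bool" where
  "hyperplane M H \<longleftrightarrow> flat M H \<and> rank_of M H + 1 = matroid_rank M"

definition stressed_hyperplane :: "'a basis_system \<Rightarrow> 'a set \<Rightarrow> bool" where
  "stressed_hyperplane M H \<longleftrightarrow>
     hyperplane M H \<and> (\<forall>S. S \<subseteq> H \<and> card S = matroid_rank M \<longrightarrow> circuit M S)"

definition relaxation :: "'a basis_system \<Rightarrow> 'a set \<Rightarrow> 'a basis_system" where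
  "relaxation M H =
     \<lparr>ground = ground M, bases = bases M \<union> {S. S \<subseteq> H \<and> card S = matroid_rank M}\<rparr>"

definition symmetric_exchange ::
    "'a basis_system \<Rightarrow> 'a set \<times> 'a set \<Rightarrow> 'a set \<times> 'a set \<Rightarrow> bool" where
  "symmetric_exchange N = (\<lambda>(A, B) (A', B').
     A \<in> bases N \<and> B \<in> bases N \<and>
     (\<exists>a\<in>A - B. \<exists>b\<in>B - A.
        A' = (A \<union> {b}) - {a} \<and> B' = (B \<union> {a}) - {b} \<and> A' \<in> bases N \<and> B' \<in> bases N))"

text \<open>
  Ordered tuples are lists, indexed from 0.
\<close>

definition basis_tuples :: "'a basis_system \<Rightarrow> nat \<Rightarrow> 'a set list set" where
  "basis_tuples N n = {Bs. length Bs = n \<and> set Bs \<subseteq> bases N}"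

definition exchange_step ::
    "'a basis_system \<Rightarrow> nat \<Rightarrow> 'a set list \<Rightarrow> 'a set list \<Rightarrow> bool" where
  "exchange_step N n Bs Cs \<longleftrightarrow>
     (\<exists>i<n. \<exists>j<n. i \<noteq> j \<and>
        symmetric_exchange N (Bs ! i, Bs ! j) (Cs ! i, Cs ! j) \<and>
        (\<forall>k<n. k \<noteq> i \<and> k \<noteq> j \<longrightarrow> Cs ! k = Bs ! k))"

text \<open>
  Only the values \<open>F 0, \<dots>, F l\<close> are relevant.
\<close>

definition exchange_sequence ::
    "'a basis_system \<Rightarrow> nat \<Rightarrow> nat \<Rightarrow> (nat \<Rightarrow> 'a set list) \<Rightarrow> 'a set list \<Rightarrow> 'a set list \<Rightarrow> bool" where
  "exchange_sequence N n l F Bs Cs \<longleftrightarrow>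
     F 0 = Bs \<and> F l = Cs \<and>
     (\<forall>t\<le>l. F t \<in> basis_tuples N n) \<and>
     (\<forall>t. 0 < t \<and> t \<le> l \<longrightarrow> exchange_step N n (F (t - 1)) (F t))"

definition multiset_union :: "'a set list \<Rightarrow> 'a multiset" where
  "multiset_union Bs = (\<Sum>B\<leftarrow>Bs. mset_set B)"

definition White_conjecture :: "'a basis_system \<Rightarrow> bool" where
  "White_conjecture N \<longleftrightarrow>
     (\<forall>n\<ge>1. \<forall>Bs\<in>basis_tuples N n. \<forall>Cs\<in>basis_tuples N n.
        multiset_union Bs = multiset_union Cs \<longrightarrow> (\<exists>l F. exchange_sequence N n l F Bs Cs))"

definition condition_star :: "'a basis_system \<Rightarrow> 'a set \<Rightarrow> bool" where
  "condition_star M H \<longleftrightarrow>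
     (\<forall>n\<in>{2, 3}. \<forall>Bs\<in>basis_tuples M n. \<forall>Cs\<in>basis_tuples M n.
        (\<exists>F. exchange_sequence (relaxation M H) n 2 F Bs Cs) \<longrightarrow>
        (\<exists>l F. exchange_sequence M n l F Bs Cs))"

end

theory Submission
  imports Defs
begin

text \<open>
  Call a set of size \<open>r\<close> inside \<open>H\<close> a new basis. Everything rests on two facts about bases.
  First, every set \<open>insert e S\<close> with \<open>S \<subseteq> H\<close>, \<open>card S = r - 1\<close> and \<open>e\<close> outside \<open>H\<close> is a basis of \<open>M\<close>
  (\<open>stressed_hyperplane_near_basis\<close>), so exchanging an element of a new basis for an element outside
  \<open>H\<close> always gives a basis of \<open>M\<close>. Second, by exchanging against such a set, an outside element \<open>b\<close>
  of a basis \<open>J\<close> of \<open>M\<close> that has another outside element can be replaced by a member of any given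
  \<open>(r - 1)\<close>-subset of \<open>H\<close> (\<open>basis_exchange2\<close>). Hence a new basis and a basis with at least two outside
  elements always admit an exchange that turns both into bases of \<open>M\<close>; such an exchange is called a
  reduction.

  White's conjecture passes to the relaxation: perform reductions on two tuples with the same multiset
  union as long as possible. Each ends either with bases of \<open>M\<close> only, or with sets that have at most
  one element outside \<open>H\<close>, at least one of them having none. The total number of outside elements is at
  least the length of the tuple in the first case and smaller in the second, so both tuples end in the
  same case. In the first case White's conjecture for \<open>M\<close> applies. In the second, all sets of size
  \<open>r\<close> with at most one outside element are bases of the relaxation, and they behave like the bases of
  a uniform matroid with one element replaced by a parallel class: the entries can be corrected one
  position at a time (\<open>thin_connected\<close>).

  White's conjecture passes back to \<open>M\<close>: a sequence in the relaxation between tuples of bases of \<open>M\<close>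
  is changed so that the maximal number \<open>k\<close> of new bases in its tuples goes down (\<open>lower_peaks\<close>). A tuple
  with \<open>k\<close> new bases is replaced by one of its reductions, so two things are needed.
  Any two reductions of the same tuple must be connected through tuples with fewer than \<open>k\<close> new bases
  (\<open>reduced_connected\<close>). If they act on the same new basis, then at most three positions are involved.
  On these both reductions have bases of \<open>M\<close> only, and the tuple itself is the middle term of a sequence of length
  two between them, so the condition on \<open>M\<close> applies. If they act on different new bases they can be made to commute.
  And for an exchange between two tuples with \<open>k\<close> new bases each, some reductions of the two must be
  connected in this way (\<open>linked_plateau\<close>). There is an explicit short path in every case, depending on which
  of the sets that take part are new and on whether the exchanged elements lie in \<open>H\<close>.
\<close>

section \<open>Exchanges between the members of a family\<close>

definition exchanged :: "'a set \<Rightarrow> 'a set \<Rightarrow> 'a set \<Rightarrow> 'a set \<Rightarrow> bool" where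
  "exchanged A B A' B' \<longleftrightarrow>
     (\<exists>a\<in>A - B. \<exists>b\<in>B - A. A' = insert b (A - {a}) \<and> B' = insert a (B - {b}))"

text \<open>
  Only the four sets that take part are required to lie in \<open>\<F>\<close>, and only the two positions that
  change are required to lie in \<open>I\<close>. The relation is therefore monotone in both arguments, so a path found on
  few positions, or among few sets, is at once a path in any larger setting.
\<close>

definition exch :: "'a set set \<Rightarrow> 'i set \<Rightarrow> ('i \<Rightarrow> 'a set) \<Rightarrow> ('i \<Rightarrow> 'a set) \<Rightarrow> bool" where
  "exch \<F> I f g \<longleftrightarrow>
     (\<exists>p\<in>I. \<exists>q\<in>I. p \<noteq> q \<and> {f p, f q, g p, g q} \<subseteq> \<F> \<and>
        exchanged (f p) (f q) (g p) (g q) \<and> (\<forall>k. k \<noteq> p \<longrightarrow> k \<noteq> q \<longrightarrow> g k = f k))"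

lemma exch_pairE:
  assumes "exch \<F> I f g"
  obtains p q where "p \<in> I" "q \<in> I" "p \<noteq> q" "{f p, f q, g p, g q} \<subseteq> \<F>"
    "exchanged (f p) (f q) (g p) (g q)" "\<forall>k. k \<noteq> p \<longrightarrow> k \<noteq> q \<longrightarrow> g k = f k"
  using assms unfolding exch_def by blast

lemma exchanged_sym: "exchanged A B A' B' \<Longrightarrow> exchanged A' B' A B"
  unfolding exchanged_def
proof (elim bexE conjE)
  fix a b assume "a \<in> A - B" "b \<in> B - A" "A' = insert b (A - {a})" "B' = insert a (B - {b})"
  then show "\<exists>a\<in>A' - B'. \<exists>b\<in>B' - A'. A = insert b (A' - {a}) \<and> B = insert a (B' - {b})"
    by (intro bexI[of _ b] bexI[of _ a]) auto
qed

lemma exch_sym: "exch \<F> I f g \<Longrightarrow> exch \<F> I g f"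
  unfolding exch_def by (metis (no_types, lifting) exchanged_sym insert_subset)

lemma exch_rtranclp_sym: "(exch \<F> I)\<^sup>*\<^sup>* f g \<Longrightarrow> (exch \<F> I)\<^sup>*\<^sup>* g f"
  by (metis exch_sym symp_def symp_rtranclp)

lemma exch_mono: "\<F> \<subseteq> \<G> \<Longrightarrow> I \<subseteq> J \<Longrightarrow> exch \<F> I f g \<Longrightarrow> exch \<G> J f g"
  unfolding exch_def by (meson order_trans subsetD)

lemma exch_rtranclp_mono:
  assumes "\<F> \<subseteq> \<G>" "I \<subseteq> J" "(exch \<F> I)\<^sup>*\<^sup>* f g"
  shows "(exch \<G> J)\<^sup>*\<^sup>* f g"
  using assms(3) by (rule mono_rtranclp[rule_format, rotated]) (rule exch_mono[OF assms(1,2)])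

lemma exchI:
  assumes "p \<in> I" "q \<in> I" "p \<noteq> q" "f p \<in> \<F>" "f q \<in> \<F>"
    and "a \<in> f p" "a \<notin> f q" "b \<in> f q" "b \<notin> f p"
    and "insert b (f p - {a}) \<in> \<F>" "insert a (f q - {b}) \<in> \<F>"
  shows "exch \<F> I f (f(p := insert b (f p - {a}), q := insert a (f q - {b})))"
  unfolding exch_def exchanged_def using assms
  by (intro bexI[of _ p] bexI[of _ q] conjI bexI[of _ a] bexI[of _ b]) auto

lemma exchE:
  assumes "exch \<F> I f g"
  obtains p q a b where "p \<in> I" "q \<in> I" "p \<noteq> q" "f p \<in> \<F>" "f q \<in> \<F>"
    "a \<in> f p" "a \<notin> f q" "b \<in> f q" "b \<notin> f p"
    "insert b (f p - {a}) \<in> \<F>" "insert a (f q - {b}) \<in> \<F>"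
    "g = f(p := insert b (f p - {a}), q := insert a (f q - {b}))"
proof -
  obtain p q where pq: "p \<in> I" "q \<in> I" "p \<noteq> q" "{f p, f q, g p, g q} \<subseteq> \<F>"
    "exchanged (f p) (f q) (g p) (g q)" "\<forall>k. k \<noteq> p \<longrightarrow> k \<noteq> q \<longrightarrow> g k = f k"
    by (rule exch_pairE[OF assms])
  then obtain a b where ab: "a \<in> f p - f q" "b \<in> f q - f p"
    "g p = insert b (f p - {a})" "g q = insert a (f q - {b})"
    unfolding exchanged_def by blast
  have "g = f(p := insert b (f p - {a}), q := insert a (f q - {b}))"
    using pq(3,6) ab(3,4) by (auto simp: fun_eq_iff)
  then show ?thesis using that pq ab by auto
qed

text \<open>
  The case \<open>x = y\<close>, in which nothing happens, is included. It lets one explicit path serve several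
  configurations of elements, with some of its steps trivial.
\<close>

lemma exch_insert:
  assumes "p \<in> I" "q \<in> I" "p \<noteq> q" "f p = insert x S" "f q = insert y T"
    and "x \<notin> S" "x \<notin> T" "y \<notin> S" "y \<notin> T"
    and "insert x S \<in> \<F>" "insert y T \<in> \<F>" "insert y S \<in> \<F>" "insert x T \<in> \<F>"
  shows "(exch \<F> I)\<^sup>*\<^sup>* f (f(p := insert y S, q := insert x T))"
proof (cases "x = y")
  case True
  then have "f(p := insert y S, q := insert x T) = f"
    using assms by (simp add: fun_eq_iff)
  then show ?thesis by simp
next
  case False
  have "exch \<F> I f (f(p := insert y (f p - {x}), q := insert x (f q - {y})))"
    using assms False by (intro exchI) auto
  moreover have "insert y (f p - {x}) = insert y S" "insert x (f q - {y}) = insert x T"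
    using assms by auto
  ultimately show ?thesis by simp
qed

text \<open>
  The next three lemmas exchange between two of three displayed positions, so that paths among
  three sets can be written down as chains of triples.
\<close>

lemma exch_12:
  assumes "i \<in> I" "p \<in> I" "i \<noteq> p" "i \<noteq> q" "p \<noteq> q"
    and "x \<notin> S" "x \<notin> T" "y \<notin> S" "y \<notin> T"
    and "insert x S \<in> \<F>" "insert y T \<in> \<F>" "insert y S \<in> \<F>" "insert x T \<in> \<F>"
  shows "(exch \<F> I)\<^sup>*\<^sup>* (f(i := insert x S, p := insert y T, q := C)) (f(i := insert y S, p := insert x T, q := C))"
  using exch_insert[of i I p "f(i := insert x S, p := insert y T, q := C)" x S y T \<F>] assms
  by (simp add: fun_upd_twist)

lemma exch_13:
  assumes "i \<in> I" "q \<in> I" "i \<noteq> p" "i \<noteq> q" "p \<noteq> q"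
    and "x \<notin> S" "x \<notin> T" "y \<notin> S" "y \<notin> T"
    and "insert x S \<in> \<F>" "insert y T \<in> \<F>" "insert y S \<in> \<F>" "insert x T \<in> \<F>"
  shows "(exch \<F> I)\<^sup>*\<^sup>* (f(i := insert x S, p := B, q := insert y T)) (f(i := insert y S, p := B, q := insert x T))"
  using exch_insert[of i I q "f(i := insert x S, p := B, q := insert y T)" x S y T \<F>] assms
  by (simp add: fun_upd_twist)

lemma exch_23:
  assumes "p \<in> I" "q \<in> I" "i \<noteq> p" "i \<noteq> q" "p \<noteq> q"
    and "x \<notin> S" "x \<notin> T" "y \<notin> S" "y \<notin> T"
    and "insert x S \<in> \<F>" "insert y T \<in> \<F>" "insert y S \<in> \<F>" "insert x T \<in> \<F>"
  shows "(exch \<F> I)\<^sup>*\<^sup>* (f(i := A, p := insert x S, q := insert y T)) (f(i := A, p := insert y S, q := insert x T))"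
  using exch_insert[of p I q "f(i := A, p := insert x S, q := insert y T)" x S y T \<F>] assms
  by (simp add: fun_upd_twist)

lemma sum_upd2:
  fixes \<phi> :: "'a set \<Rightarrow> nat"
  assumes "finite I" "p \<in> I" "q \<in> I" "p \<noteq> q"
  shows "(\<Sum>k\<in>I. \<phi> ((f(p := A, q := B)) k)) + \<phi> (f p) + \<phi> (f q) = (\<Sum>k\<in>I. \<phi> (f k)) + \<phi> A + \<phi> B"
proof -
  have split: "(\<Sum>k\<in>I. h k) = h p + (h q + (\<Sum>k\<in>I - {p} - {q}. h k))" for h :: "'b \<Rightarrow> nat"
    using assms by (subst sum.remove[of _ p], simp_all, subst sum.remove[of _ q], simp_all)
  have "(\<Sum>k\<in>I - {p} - {q}. \<phi> ((f(p := A, q := B)) k)) = (\<Sum>k\<in>I - {p} - {q}. \<phi> (f k))"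
    by (intro sum.cong) auto
  then show ?thesis
    unfolding split[of "\<lambda>k. \<phi> ((f(p := A, q := B)) k)"] split[of "\<lambda>k. \<phi> (f k)"]
    using assms(4) by simp
qed

lemma exch_invariant:
  fixes \<phi> :: "'a set \<Rightarrow> nat"
  assumes "finite I" "exch \<F> I f g"
    and "\<And>A B a b. A \<in> \<F> \<Longrightarrow> B \<in> \<F> \<Longrightarrow> a \<in> A \<Longrightarrow> a \<notin> B \<Longrightarrow> b \<in> B \<Longrightarrow> b \<notin> A \<Longrightarrow>
       insert b (A - {a}) \<in> \<F> \<Longrightarrow> insert a (B - {b}) \<in> \<F> \<Longrightarrow>
       \<phi> (insert b (A - {a})) + \<phi> (insert a (B - {b})) = \<phi> A + \<phi> B"
  shows "(\<Sum>k\<in>I. \<phi> (g k)) = (\<Sum>k\<in>I. \<phi> (f k))"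
  using assms(2)
proof (cases rule: exchE)
  case (1 p q a b)
  have e: "\<phi> (insert b (f p - {a})) + \<phi> (insert a (f q - {b})) = \<phi> (f p) + \<phi> (f q)"
    by (rule assms(3)) (use 1 in auto)
  show ?thesis unfolding 1(12)
    using sum_upd2[OF assms(1) 1(1-3), of \<phi> f "insert b (f p - {a})" "insert a (f q - {b})"] e
    by linarith
qed

lemma exch_multiplicity:
  assumes "finite I" "(exch \<F> I)\<^sup>*\<^sup>* f g"
  shows "(\<Sum>k\<in>I. of_bool (x \<in> g k)) = (\<Sum>k\<in>I. of_bool (x \<in> f k) :: nat)"
  using assms(2)
proof induction
  case (step g h)
  have "(\<Sum>k\<in>I. of_bool (x \<in> h k) :: nat) = (\<Sum>k\<in>I. of_bool (x \<in> g k))"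
    by (rule exch_invariant[OF assms(1) step(2)]) auto
  then show ?case using step.IH by simp
qed simp

lemma exch_members:
  assumes "(exch \<F> I)\<^sup>*\<^sup>* f g" "\<forall>k\<in>I. f k \<in> \<F>"
  shows "\<forall>k\<in>I. g k \<in> \<F>"
  using assms
proof induction
  case (step g h)
  from step(2) show ?case
    by (cases rule: exchE) (use step in auto)
qed simp

lemma exch_outside:
  assumes "(exch \<F> I)\<^sup>*\<^sup>* f g" "k \<notin> I"
  shows "g k = f k"
  using assms(1)
proof induction
  case (step g h)
  from step(2) show ?case
    by (cases rule: exchE) (use step assms(2) in auto)
qed simp

text \<open>
  The multiplicity of \<open>x\<close> in the multiset union of the family.
\<close>

definition occ :: "'i set \<Rightarrow> ('i \<Rightarrow> 'a set) \<Rightarrow> 'a \<Rightarrow> nat" where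
  "occ I f x = (\<Sum>k\<in>I. of_bool (x \<in> f k))"

lemma exch_occ: "finite I \<Longrightarrow> (exch \<F> I)\<^sup>*\<^sup>* f g \<Longrightarrow> occ I g x = occ I f x"
  unfolding occ_def by (rule exch_multiplicity)

lemma occ_member:
  assumes "finite I" "occ I f x = occ I g x" "i \<in> I" "x \<in> g i"
  shows "\<exists>j\<in>I. x \<in> f j"
proof (rule ccontr)
  assume "\<not> ?thesis"
  then have "occ I f x = 0" by (simp add: occ_def)
  moreover have "occ I g x \<noteq> 0" using assms(1,3,4) by (auto simp: occ_def)
  ultimately show False using assms(2) by simp
qed

lemma occ_nonmember:
  assumes "finite I" "occ I f x = occ I g x" "i \<in> I" "x \<notin> g i"
  shows "\<exists>j\<in>I. x \<notin> f j"
proof (rule ccontr)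
  assume "\<not> ?thesis"
  then have "occ I f x = (\<Sum>k\<in>I. 1)" unfolding occ_def by (intro sum.cong) auto
  moreover have "occ I g x < (\<Sum>k\<in>I. 1)"
    unfolding occ_def using assms(1,3,4) by (intro sum_strict_mono_ex1) auto
  ultimately show False using assms(2) by simp
qed

section \<open>Stressed hyperplanes in terms of bases\<close>

text \<open>
  What the argument uses about a matroid with a stressed hyperplane, in terms of its bases \<open>\<B>\<close>.
\<close>

locale stressed =
  fixes \<B> :: "'a set set" and H E :: "'a set" and r :: nat
  assumes finite_E: "finite E" and H_sub: "H \<subseteq> E"
    and basis_sub: "B \<in> \<B> \<Longrightarrow> B \<subseteq> E"
    and basis_card: "B \<in> \<B> \<Longrightarrow> card B = r"
    and basis_out: "B \<in> \<B> \<Longrightarrow> \<not> B \<subseteq> H"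
    and exchange: "A \<in> \<B> \<Longrightarrow> B \<in> \<B> \<Longrightarrow> a \<in> A \<Longrightarrow> a \<notin> B \<Longrightarrow> \<exists>b\<in>B - A. insert b (A - {a}) \<in> \<B>"
    and near: "S \<subseteq> H \<Longrightarrow> Suc (card S) = r \<Longrightarrow> e \<in> E \<Longrightarrow> e \<notin> H \<Longrightarrow> insert e S \<in> \<B>"
begin

definition relaxed :: "'a set set" where
  "relaxed = \<B> \<union> {S. S \<subseteq> H \<and> card S = r}"

lemma bases_relaxed: "\<B> \<subseteq> relaxed"
  by (auto simp: relaxed_def)

lemma relaxedI: "S \<subseteq> H \<Longrightarrow> card S = r \<Longrightarrow> S \<in> relaxed"
  by (auto simp: relaxed_def)

lemma relaxed_basis: "B \<in> relaxed \<Longrightarrow> \<not> B \<subseteq> H \<Longrightarrow> B \<in> \<B>"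
  by (auto simp: relaxed_def)

lemma relaxed_sub: "B \<in> relaxed \<Longrightarrow> B \<subseteq> E"
  using basis_sub H_sub by (auto simp: relaxed_def)

lemma relaxed_card: "B \<in> relaxed \<Longrightarrow> card B = r"
  using basis_card by (auto simp: relaxed_def)

lemma relaxed_finite: "B \<in> relaxed \<Longrightarrow> finite B"
  using relaxed_sub finite_E finite_subset by blast

lemma finite_H: "finite H"
  using H_sub finite_E finite_subset by blast

lemma card_remove1: "A \<subseteq> H \<Longrightarrow> card A = r \<Longrightarrow> a \<in> A \<Longrightarrow> Suc (card (A - {a})) = r"
  using finite_subset[OF _ finite_H, of A] by (metis card_Suc_Diff1)

lemma near_remove:
  assumes "A \<subseteq> H" "card A = r" "a \<in> A" "b \<in> E" "b \<notin> H"
  shows "insert b (A - {a}) \<in> \<B>"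
  using assms card_remove1 by (intro near) blast+

lemma near_insert:
  assumes "S \<subseteq> H" "Suc (Suc (card S)) = r" "x \<in> H" "x \<notin> S" "e \<in> E" "e \<notin> H"
  shows "insert x (insert e S) \<in> \<B>" "insert e (insert x S) \<in> \<B>"
  using near[of "insert x S" e] assms finite_subset[OF assms(1) finite_H] by (auto simp: insert_commute)

lemma card_remove2: "A \<subseteq> H \<Longrightarrow> card A = r \<Longrightarrow> a \<in> A \<Longrightarrow> a' \<in> A \<Longrightarrow> a \<noteq> a' \<Longrightarrow> Suc (Suc (card (A - {a, a'}))) = r"
  using finite_subset[OF _ finite_H, of A]
  by (metis Diff_insert2 card_Suc_Diff1 finite_Diff insertE insert_Diff)

text \<open>
  The set \<open>insert e S\<close> is a basis, and \<open>e\<close> already lies in \<open>J\<close>, so exchanging \<open>b\<close> against this basis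
  can only bring in an element of \<open>S\<close>.
\<close>

lemma basis_exchange2:
  assumes J: "J \<in> \<B>" "b \<in> J" "e \<in> J" "b \<noteq> e" "b \<notin> H" "e \<notin> H"
    and S: "S \<subseteq> H" "Suc (card S) = r"
  shows "\<exists>a\<in>S - J. insert a (J - {b}) \<in> \<B>"
proof -
  have "insert e S \<in> \<B>"
    using near[OF S] J basis_sub by blast
  moreover have "b \<notin> insert e S" using J S by auto
  ultimately obtain a where "a \<in> insert e S - J" "insert a (J - {b}) \<in> \<B>"
    using exchange[OF J(1) _ J(2)] by blast
  then show ?thesis using J by auto
qed

text \<open>
  Applying the previous lemma to \<open>A - {u}\<close> keeps one prescribed element \<open>u\<close> of \<open>A\<close> out of the
  exchange.
\<close>

lemma basis_exchange_relaxed: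
  assumes J: "J \<in> \<B>" "b \<in> J" "e \<in> J" "b \<noteq> e" "b \<notin> H" "e \<notin> H"
    and A: "A \<subseteq> H" "card A = r"
  shows "\<exists>a\<in>A - J. a \<noteq> u \<and> insert a (J - {b}) \<in> \<B>"
proof -
  have "r > 0" using J basis_card[of J] basis_sub[of J] finite_E finite_subset
    by (metis card_gt_0_iff empty_iff)
  then obtain x where "x \<in> A" "u \<in> A \<longrightarrow> x = u"
    using A by (metis card.empty equals0I less_numeral_extra(3))
  then have "\<exists>a\<in>(A - {x}) - J. insert a (J - {b}) \<in> \<B>"
    using A card_remove1 by (intro basis_exchange2[OF J]) blast+
  then show ?thesis using \<open>u \<in> A \<longrightarrow> x = u\<close> by auto
qed

section \<open>Reducing the number of new bases\<close>

definition n_inside :: "'i set \<Rightarrow> ('i \<Rightarrow> 'a set) \<Rightarrow> nat" where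
  "n_inside I f = (\<Sum>k\<in>I. of_bool (f k \<subseteq> H))"

definition n_outside :: "'i set \<Rightarrow> ('i \<Rightarrow> 'a set) \<Rightarrow> nat" where
  "n_outside I f = (\<Sum>k\<in>I. card (f k - H))"

text \<open>
  The exchange of \<open>a\<close> in the new basis \<open>f i\<close> for \<open>b\<close> in \<open>f j\<close> turns both sets into members of \<open>\<B>\<close>,
  the first of them by the locale assumption \<open>near\<close>.
\<close>

definition reducible :: "'i set \<Rightarrow> ('i \<Rightarrow> 'a set) \<Rightarrow> 'i \<Rightarrow> 'i \<Rightarrow> 'a \<Rightarrow> 'a \<Rightarrow> bool" where
  "reducible I f i j a b \<longleftrightarrow>
     i \<in> I \<and> j \<in> I \<and> f i \<subseteq> H \<and> card (f i) = r \<and> f j \<in> \<B> \<and>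
     a \<in> f i \<and> a \<notin> f j \<and> b \<in> f j \<and> b \<notin> H \<and> insert a (f j - {b}) \<in> \<B>"

definition reduced :: "('i \<Rightarrow> 'a set) \<Rightarrow> 'i \<Rightarrow> 'i \<Rightarrow> 'a \<Rightarrow> 'a \<Rightarrow> 'i \<Rightarrow> 'a set" where
  "reduced f i j a b = f(i := insert b (f i - {a}), j := insert a (f j - {b}))"

lemma reducible_neq: "reducible I f i j a b \<Longrightarrow> i \<noteq> j"
  using basis_out by (auto simp: reducible_def)

lemma reducible_basis: "reducible I f i j a b \<Longrightarrow> insert b (f i - {a}) \<in> \<B>"
  unfolding reducible_def using near_remove basis_sub by blast

lemma reducible_exch:
  assumes "reducible I f i j a b"
  shows "exch relaxed I f (reduced f i j a b)"
  unfolding reduced_def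
  using assms reducible_neq[OF assms] reducible_basis[OF assms] bases_relaxed relaxedI
  by (intro exchI) (auto simp: reducible_def)

lemma reducible_n_inside:
  assumes "finite I" "reducible I f i j a b"
  shows "Suc (n_inside I (reduced f i j a b)) = n_inside I f"
proof -
  have "\<not> insert b (f i - {a}) \<subseteq> H" "\<not> insert a (f j - {b}) \<subseteq> H" "\<not> f j \<subseteq> H" "f i \<subseteq> H"
    using assms(2) basis_out reducible_basis[OF assms(2)] by (auto simp: reducible_def)
  moreover have "i \<in> I" "j \<in> I" using assms(2) by (auto simp: reducible_def)
  ultimately show ?thesis
    using sum_upd2[OF assms(1) _ _ reducible_neq[OF assms(2)],
        of "\<lambda>B. of_bool (B \<subseteq> H)" f "insert b (f i - {a})" "insert a (f j - {b})"]
    unfolding reduced_def n_inside_def by simp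
qed

lemma exch_basis_n_inside:
  assumes "finite I" "exch \<B> I f g"
  shows "n_inside I g = n_inside I f"
  unfolding n_inside_def by (rule exch_invariant[OF assms]) (use basis_out in auto)

lemma exch_n_outside:
  assumes "finite I" "exch relaxed I f g"
  shows "n_outside I g = n_outside I f"
  unfolding n_outside_def
proof (rule exch_invariant[OF assms])
  fix A B a b
  assume *: "A \<in> relaxed" "B \<in> relaxed" "a \<in> A" "a \<notin> B" "b \<in> B" "b \<notin> A"
  have "card (insert b (A - {a}) - H) + of_bool (a \<notin> H) = card (A - H) + of_bool (b \<notin> H)"
    if "finite A" "a \<in> A" "b \<notin> A" for A a b
  proof -
    have "card (insert x C - H) = card (C - H) + of_bool (x \<notin> H)" if "finite C" "x \<notin> C" for C x
      using that by (simp add: insert_Diff_if)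
    from this[of "A - {a}" b] this[of "A - {a}" a] show ?thesis
      using that by (simp add: insert_absorb)
  qed
  from this[of A a b] this[of B b a]
  show "card (insert b (A - {a}) - H) + card (insert a (B - {b}) - H) = card (A - H) + card (B - H)"
    using * relaxed_finite by simp
qed

abbreviation moved :: "('i \<Rightarrow> 'a set) \<Rightarrow> 'i \<Rightarrow> 'i \<Rightarrow> 'a \<Rightarrow> 'a \<Rightarrow> 'i \<Rightarrow> 'a set" where
  "moved f p q u v \<equiv> f(p := insert v (f p - {u}), q := insert u (f q - {v}))"

text \<open>
  The bases that can absorb an element of a new basis and still meet the complement of \<open>H\<close>.
\<close>

definition heavy :: "'a set \<Rightarrow> bool" where
  "heavy J \<longleftrightarrow> (\<exists>b\<in>J - H. \<exists>e\<in>J - H. b \<noteq> e)"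

lemma not_heavy: "finite J \<Longrightarrow> \<not> heavy J \<Longrightarrow> card (J - H) \<le> 1"
  unfolding heavy_def using card_le_Suc0_iff_eq[of "J - H"] by auto

lemma heavy_not_inside: "heavy J \<Longrightarrow> \<not> J \<subseteq> H"
  by (auto simp: heavy_def)

lemma heavy_exists:
  assumes I: "finite I" and val: "\<forall>k\<in>I. f k \<in> relaxed" and i: "i \<in> I" "f i \<subseteq> H"
    and w: "card I \<le> n_outside I f"
  shows "\<exists>j\<in>I. heavy (f j)"
proof (rule ccontr)
  assume "\<not> ?thesis"
  then have le: "card (f k - H) \<le> 1" if "k \<in> I" for k
    using not_heavy relaxed_finite val that by blast
  moreover have "card (f i - H) < 1" using i by (simp add: Diff_eq_empty_iff[THEN iffD2])
  ultimately have "n_outside I f < (\<Sum>k\<in>I. 1)"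
    unfolding n_outside_def using I i(1) by (intro sum_strict_mono_ex1) auto
  then show False using w by simp
qed

text \<open>
  A new basis and a heavy set always allow a reduction, by exchanging any outside element of the
  heavy set.
\<close>

lemma reducible_exists:
  assumes val: "\<forall>k\<in>I. f k \<in> relaxed" and i: "i \<in> I" "f i \<subseteq> H" and j: "j \<in> I" "heavy (f j)"
  shows "\<exists>a b. reducible I f i j a b"
proof -
  obtain b e where be: "b \<in> f j" "e \<in> f j" "b \<noteq> e" "b \<notin> H" "e \<notin> H"
    using j(2) by (auto simp: heavy_def)
  have J: "f j \<in> \<B>" using relaxed_basis heavy_not_inside val j by blast
  have c: "card (f i) = r" using relaxed_card val i by blast
  obtain a where "a \<in> f i" "a \<notin> f j" "insert a (f j - {b}) \<in> \<B>"
    using basis_exchange_relaxed[OF J be i(2) c] by blast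
  then show ?thesis using i j J be c by (auto simp: reducible_def)
qed

lemma n_outside_occ:
  assumes I: "finite I" and f: "\<forall>k\<in>I. f k \<subseteq> E"
  shows "n_outside I f = (\<Sum>x\<in>E - H. occ I f x)"
proof -
  have "card (f k - H) = (\<Sum>x\<in>E - H. of_bool (x \<in> f k))" if "k \<in> I" for k
  proof -
    have "f k - H = (E - H) \<inter> {x. x \<in> f k}" using f that by blast
    then show ?thesis using finite_E by simp
  qed
  then have "n_outside I f = (\<Sum>k\<in>I. \<Sum>x\<in>E - H. of_bool (x \<in> f k))"
    unfolding n_outside_def by (intro sum.cong) auto
  also have "\<dots> = (\<Sum>x\<in>E - H. occ I f x)"
    unfolding occ_def by (rule sum.swap)
  finally show ?thesis .
qed

section \<open>Sets with at most one element outside the hyperplane\<close>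

text \<open>
  These are the bases of the matroid obtained from the uniform matroid of rank \<open>r\<close> on \<open>H\<close> and one
  further element by replacing that element with the parallel class of all elements outside \<open>H\<close>.
\<close>

definition thin :: "'a set set" where
  "thin = {B. B \<subseteq> E \<and> card B = r \<and> card (B - H) \<le> 1}"

lemma thin_finite: "B \<in> thin \<Longrightarrow> finite B"
  using finite_E finite_subset by (auto simp: thin_def)

lemma thin_card: "B \<in> thin \<Longrightarrow> card B = r"
  by (simp add: thin_def)

lemma thin_unique: "B \<in> thin \<Longrightarrow> x \<in> B - H \<Longrightarrow> y \<in> B - H \<Longrightarrow> x = y"
proof -
  assume B: "B \<in> thin" and xy: "x \<in> B - H" "y \<in> B - H"
  have "card (B - H) \<le> Suc 0" using B by (simp add: thin_def)
  moreover have "finite (B - H)" using thin_finite[OF B] by simp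
  ultimately show "x = y" using xy card_le_Suc0_iff_eq by blast
qed

lemma thin_relaxed: "thin \<subseteq> relaxed"
proof
  fix B assume B: "B \<in> thin"
  show "B \<in> relaxed"
  proof (cases "B \<subseteq> H")
    case True
    then show ?thesis using B thin_card relaxedI by blast
  next
    case False
    then obtain e where e: "e \<in> B" "e \<notin> H" by blast
    then have 1: "B - {e} \<subseteq> H" using thin_unique[OF B] by blast
    have 2: "Suc (card (B - {e})) = r"
      using card_Suc_Diff1[OF thin_finite[OF B] e(1)] thin_card[OF B] by simp
    then have "insert e (B - {e}) \<in> \<B>" using near[OF 1 2] e B unfolding thin_def by blast
    then show ?thesis using e bases_relaxed by (simp add: insert_absorb subset_iff)
  qed
qed

lemma thin_diff: "A \<in> thin \<Longrightarrow> B \<in> thin \<Longrightarrow> A \<noteq> B \<Longrightarrow> \<exists>y. y \<in> A \<and> y \<notin> B"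
  using card_subset_eq[of B A] thin_finite thin_card by (metis subsetI)

lemma thin_replace:
  assumes B: "B \<in> thin" and xy: "x \<in> B" "y \<notin> B" "y \<in> E" and c: "y \<in> H \<or> x \<notin> H \<or> B \<subseteq> H"
  shows "insert y (B - {x}) \<in> thin"
proof -
  have fin: "finite B" using B thin_finite by blast
  have "card (insert y (B - {x}) - H) \<le> 1"
  proof (cases "y \<in> H")
    case True
    then have "insert y (B - {x}) - H \<subseteq> B - H" by blast
    then have "card (insert y (B - {x}) - H) \<le> card (B - H)" using fin by (intro card_mono) auto
    then show ?thesis using B by (simp add: thin_def)
  next
    case False
    then have "insert y (B - {x}) - H \<subseteq> {y}" using c thin_unique[OF B, of x] xy by blast
    then have "card (insert y (B - {x}) - H) \<le> card {y}" by (intro card_mono) auto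
    then show ?thesis by simp
  qed
  moreover have "card (insert y (B - {x})) = r"
    using card_Suc_Diff1[OF fin xy(1)] xy fin thin_card[OF B] by simp
  ultimately show ?thesis using B xy unfolding thin_def by blast
qed

lemma thin_exch:
  assumes "p \<in> I" "q \<in> I" "p \<noteq> q" "f p \<in> thin" "f q \<in> thin"
    and "x \<in> f p" "x \<notin> f q" "y \<in> f q" "y \<notin> f p"
    and "y \<in> H \<or> x \<notin> H \<or> f p \<subseteq> H" "x \<in> H \<or> y \<notin> H \<or> f q \<subseteq> H"
  shows "exch thin I f (moved f p q x y)"
proof -
  have "x \<in> E" "y \<in> E" using assms by (auto simp: thin_def)
  then show ?thesis using assms by (intro exchI thin_replace) auto
qed

text \<open>
  A single exchange suffices to give position \<open>i\<close> its correct outside part. If an outside element \<open>e\<close>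
  is missing at \<open>i\<close>, it is fetched from a position that has it, in return for the outside element at
  \<open>i\<close> or, if there is none, for an element of \<open>H\<close>. If the outside element at \<open>i\<close> is superfluous, some other
  position has none, because the total number of outside elements is smaller than the number of positions.
\<close>

lemma thin_align_outside:
  assumes I: "finite I" "i \<in> I" and thin: "\<forall>k\<in>I. f k \<in> thin" "\<forall>k\<in>I. g k \<in> thin"
    and occ: "\<And>x. occ I f x = occ I g x"
  shows "\<exists>f'. (exch thin I)\<^sup>*\<^sup>* f f' \<and> f' i - H = g i - H"
proof (cases "f i - H = g i - H")
  case True
  then show ?thesis by blast
next
  case ne: False
  have fi: "f i \<in> thin" and gi: "g i \<in> thin" using thin I by blast+
  show ?thesis
  proof (cases "g i \<subseteq> H")
    case False
    then obtain e where e: "e \<in> g i" "e \<notin> H" by blast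
    have ge: "g i - H = {e}" using e thin_unique[OF gi] by blast
    have efi: "e \<notin> f i"
    proof
      assume "e \<in> f i"
      then have "f i - H = {e}" using e thin_unique[OF fi] by blast
      then show False using ne ge by simp
    qed
    obtain j where j: "j \<in> I" "e \<in> f j" using occ_member[OF I(1) occ I(2) e(1)] by blast
    have fj: "f j \<in> thin" and ji: "i \<noteq> j" using j thin efi by blast+
    obtain y where y: "y \<in> f i" "y \<notin> f j" "y \<notin> H \<or> f i \<subseteq> H"
    proof (cases "f i \<subseteq> H")
      case True
      then show ?thesis using thin_diff[OF fi fj] efi j(2) that by blast
    next
      case False
      then obtain x where "x \<in> f i" "x \<notin> H" by blast
      then show ?thesis using that[of x] thin_unique[OF fj, of x e] j(2) e(2) efi by (metis DiffI)
    qed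
    have "exch thin I f (moved f i j y e)"
      by (rule thin_exch) (use I j ji fi fj y e efi in auto)
    moreover have "moved f i j y e i - H = g i - H"
    proof -
      have "f i - {y} \<subseteq> H" using y thin_unique[OF fi, of y] by blast
      then show ?thesis unfolding ge using e(2) ji by auto
    qed
    ultimately show ?thesis by blast
  next
    case gH: True
    then obtain e where e: "e \<in> f i" "e \<notin> H" using ne by blast
    have "\<exists>j\<in>I. f j \<subseteq> H"
    proof (rule ccontr)
      assume no: "\<not> ?thesis"
      have "1 \<le> card (f k - H)" if "k \<in> I" for k
        using no that thin_finite thin by (auto simp: Suc_le_eq card_gt_0_iff)
      then have "(\<Sum>k\<in>I. 1) \<le> n_outside I f" unfolding n_outside_def by (intro sum_mono)
      moreover have "n_outside I g < (\<Sum>k\<in>I. 1)"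
        unfolding n_outside_def
      proof (rule sum_strict_mono_ex1[OF I(1)])
        show "\<forall>k\<in>I. card (g k - H) \<le> 1" using thin(2) by (simp add: thin_def)
        have "card (g i - H) = 0" using gH by (metis Diff_eq_empty_iff card.empty)
        then show "\<exists>k\<in>I. card (g k - H) < 1" using I(2) by (intro bexI[of _ i]) simp_all
      qed
      moreover have "n_outside I f = n_outside I g"
        using n_outside_occ[OF I(1), of f] n_outside_occ[OF I(1), of g] thin occ by (simp add: thin_def)
      ultimately show False by simp
    qed
    then obtain j where j: "j \<in> I" "f j \<subseteq> H" by blast
    have ji: "i \<noteq> j" and fj: "f j \<in> thin" using e j thin by blast+
    obtain y where y: "y \<in> f j" "y \<notin> f i" using thin_diff[OF fj fi] e j by blast
    have "exch thin I f (moved f i j e y)"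
      by (rule thin_exch) (use I j ji fi fj y e in auto)
    moreover have "moved f i j e y i - H = g i - H"
    proof -
      have "f i - {e} \<subseteq> H" using e thin_unique[OF fi, of e] by blast
      moreover have "y \<in> H" "g i - H = {}" using y j(2) gH by blast+
      ultimately show ?thesis using ji by auto
    qed
    ultimately show ?thesis by blast
  qed
qed

text \<open>
  To trade a wrong element \<open>x\<close> at \<open>i\<close> for a missing element \<open>y\<close> found at \<open>j\<close>, the set at \<open>j\<close> must not
  contain \<open>x\<close>. If it does, \<open>x\<close> is first moved from \<open>j\<close> to a third position \<open>k\<close> without \<open>x\<close>, which exists
  since \<open>x\<close> is absent from the target at \<open>i\<close> and so does not occur everywhere.
\<close>

lemma thin_align:
  assumes I: "finite I" "i \<in> I" and g: "\<forall>k\<in>I. g k \<in> thin"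
  shows "\<forall>k\<in>I. f k \<in> thin \<Longrightarrow> (\<And>x. occ I f x = occ I g x) \<Longrightarrow> f i - H = g i - H \<Longrightarrow>
    \<exists>f'. (exch thin I)\<^sup>*\<^sup>* f f' \<and> f' i = g i"
proof (induction "card (f i - g i)" arbitrary: f rule: less_induct)
  case less
  note thin = less.prems(1) and occ = less.prems(2)
  have fi: "f i \<in> thin" and gi: "g i \<in> thin" using thin g I by blast+
  show ?case
  proof (cases "f i = g i")
    case True
    then show ?thesis by blast
  next
    case False
    then obtain x y where x: "x \<in> f i" "x \<notin> g i" and y: "y \<in> g i" "y \<notin> f i"
      using thin_diff[OF fi gi] thin_diff[OF gi fi] by blast
    have xyH: "x \<in> H" "y \<in> H" using x y less.prems(3) by blast+
    obtain j where j: "j \<in> I" "y \<in> f j" using occ_member[OF I(1) occ I(2) y(1)] by blast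
    have ji: "i \<noteq> j" using j y by blast
    have fj: "f j \<in> thin" using thin j by blast
    have "\<exists>f2. (exch thin I)\<^sup>*\<^sup>* f f2 \<and> f2 i = f i \<and> y \<in> f2 j \<and> x \<notin> f2 j"
    proof (cases "x \<in> f j")
      case False
      then show ?thesis using j by blast
    next
      case True
      obtain k where k: "k \<in> I" "x \<notin> f k" using occ_nonmember[OF I(1) occ I(2) x(2)] by blast
      have kij: "k \<noteq> i" "k \<noteq> j" using k x True by blast+
      have fk: "f k \<in> thin" using thin k by blast
      \<comment> \<open>In return for \<open>x\<close> the set at \<open>j\<close> takes an element of \<open>H\<close>, or an outside element if it has none.\<close>
      obtain z where z: "z \<in> f k" "z \<notin> f j" "z \<in> H \<or> f j \<subseteq> H"
      proof (cases "\<exists>z\<in>f k - f j. z \<in> H")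
        case True
        then show ?thesis using that by blast
      next
        case no: False
        obtain z where z: "z \<in> f k" "z \<notin> f j" using thin_diff[OF fk fj] True k by blast
        then have zH: "z \<notin> H" using no by blast
        have kzH: "f k - {z} \<subseteq> H" using thin_unique[OF fk, of z] z zH by blast
        then have "f k - {z} \<subseteq> f j - {x}"
          using no k(2) by blast
        moreover have "card (f k - {z}) = card (f j - {x})"
          using z True thin_card[OF fk] thin_card[OF fj] by simp
        ultimately have "f k - {z} = f j - {x}"
          using thin_finite[OF fj] by (intro card_subset_eq) auto
        with kzH have "f j \<subseteq> H" using xyH by blast
        then show ?thesis using that z by blast
      qed
      have "exch thin I f (moved f j k x z)"
        by (rule thin_exch) (use j k kij fj fk True z xyH in auto)
      moreover have "moved f j k x z i = f i" "y \<in> moved f j k x z j" "x \<notin> moved f j k x z j"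
        using kij ji j y x z k True by auto
      ultimately show ?thesis by blast
    qed
    then obtain f2 where f2: "(exch thin I)\<^sup>*\<^sup>* f f2" "f2 i = f i" "y \<in> f2 j" "x \<notin> f2 j" by blast
    have thin2: "\<forall>k\<in>I. f2 k \<in> thin" using exch_members[OF f2(1) thin] .
    define f3 where "f3 = moved f2 i j x y"
    have step: "exch thin I f2 f3"
      unfolding f3_def by (rule thin_exch) (use I j ji thin2 f2 x y xyH in auto)
    then have path: "(exch thin I)\<^sup>*\<^sup>* f f3" using f2(1) by simp
    have f3i: "f3 i = insert y (f i - {x})" using ji f2 by (simp add: f3_def)
    have "card (f3 i - g i) < card (f i - g i)"
      unfolding f3i using x y thin_finite[OF fi] by (intro psubset_card_mono) auto
    moreover have "\<forall>k\<in>I. f3 k \<in> thin" using exch_members[OF path thin] .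
    moreover have "occ I f3 x = occ I g x" for x using exch_occ[OF I(1) path] occ by simp
    moreover have "f3 i - H = g i - H" unfolding f3i using less.prems(3) xyH by blast
    ultimately obtain f' where f': "(exch thin I)\<^sup>*\<^sup>* f3 f'" "f' i = g i" using less.hyps by blast
    show ?thesis using rtranclp_trans[OF path f'(1)] f'(2) by blast
  qed
qed

lemma thin_connected:
  assumes "finite I"
  shows "\<forall>k\<in>I. f k \<in> thin \<Longrightarrow> \<forall>k\<in>I. g k \<in> thin \<Longrightarrow> (\<And>x. occ I f x = occ I g x) \<Longrightarrow>
    \<forall>k. k \<notin> I \<longrightarrow> f k = g k \<Longrightarrow> (exch thin I)\<^sup>*\<^sup>* f g"
  using assms
proof (induction I arbitrary: f rule: finite_induct)
  case empty
  then have "f = g" by auto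
  then show ?case by simp
next
  case (insert i I)
  let ?J = "insert i I"
  have J: "finite ?J" "i \<in> ?J" using insert.hyps by simp_all
  obtain f1 where f1: "(exch thin ?J)\<^sup>*\<^sup>* f f1" "f1 i - H = g i - H"
    using thin_align_outside[OF J insert.prems(1,2,3)] by blast
  have thin1: "\<forall>k\<in>?J. f1 k \<in> thin" using exch_members[OF f1(1) insert.prems(1)] .
  have occ1: "occ ?J f1 x = occ ?J g x" for x
    using exch_occ[OF J(1) f1(1)] insert.prems(3) by simp
  obtain f2 where f2: "(exch thin ?J)\<^sup>*\<^sup>* f1 f2" "f2 i = g i"
    using thin_align[OF J insert.prems(2) thin1 occ1 f1(2)] by blast
  have path: "(exch thin ?J)\<^sup>*\<^sup>* f f2" using f1(1) f2(1) by (rule rtranclp_trans)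
  have "\<forall>k\<in>I. f2 k \<in> thin" using exch_members[OF path insert.prems(1)] by blast
  moreover have "\<forall>k\<in>I. g k \<in> thin" using insert.prems(2) by blast
  moreover have "occ I f2 x = occ I g x" for x
  proof -
    have "occ ?J h x = of_bool (x \<in> h i) + occ I h x" for h
      unfolding occ_def using insert.hyps by (rule sum.insert)
    then show ?thesis
      using exch_occ[OF J(1) f2(1), of x] occ1[of x] f2(2) by (metis add_left_cancel)
  qed
  moreover have "\<forall>k. k \<notin> I \<longrightarrow> f2 k = g k"
    using exch_outside[OF path] insert.prems(4) f2(2) by (metis insert_iff)
  ultimately have "(exch thin I)\<^sup>*\<^sup>* f2 g" by (rule insert.IH)
  then have "(exch thin ?J)\<^sup>*\<^sup>* f2 g"
    by (rule exch_rtranclp_mono[OF subset_refl subset_insertI])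
  with path show ?case by (rule rtranclp_trans)
qed

text \<open>
  Every reduction lowers the number of new bases, and the only obstacles to a further reduction are the
  absence of new bases and the absence of heavy sets.
\<close>

lemma reduce_fully:
  assumes I: "finite I"
  shows "\<forall>k\<in>I. f k \<in> relaxed \<Longrightarrow> \<exists>f'. (exch relaxed I)\<^sup>*\<^sup>* f f' \<and>
    ((\<forall>k\<in>I. f' k \<in> \<B>) \<or> (\<exists>i\<in>I. f' i \<subseteq> H) \<and> (\<forall>k\<in>I. f' k \<in> thin))"
proof (induction "n_inside I f" arbitrary: f rule: less_induct)
  case less
  show ?case
  proof (cases "(\<exists>i\<in>I. f i \<subseteq> H) \<and> (\<exists>j\<in>I. heavy (f j))")
    case True
    then obtain i j a b where r: "reducible I f i j a b"
      using reducible_exists[OF less.prems] by blast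
    let ?f = "reduced f i j a b"
    have step: "(exch relaxed I)\<^sup>*\<^sup>* f ?f" using reducible_exch[OF r] by blast
    have "n_inside I ?f < n_inside I f" using reducible_n_inside[OF I r] by simp
    from less.hyps[OF this exch_members[OF step less.prems]]
    obtain f' where f': "(exch relaxed I)\<^sup>*\<^sup>* ?f f'"
      "(\<forall>k\<in>I. f' k \<in> \<B>) \<or> (\<exists>i\<in>I. f' i \<subseteq> H) \<and> (\<forall>k\<in>I. f' k \<in> thin)" by blast
    show ?thesis using rtranclp_trans[OF step f'(1)] f'(2) by blast
  next
    case False
    then show ?thesis
    proof (cases "\<exists>i\<in>I. f i \<subseteq> H")
      case True
      have "f k \<in> thin" if "k \<in> I" for k
      proof -
        have "f k \<in> relaxed" "\<not> heavy (f k)" using less.prems that True False by blast+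
        then show ?thesis
          using not_heavy relaxed_finite relaxed_card relaxed_sub by (simp add: thin_def)
      qed
      then show ?thesis using True by blast
    next
      case none: False
      then show ?thesis using less.prems relaxed_basis by blast
    qed
  qed
qed

text \<open>
  The total number of outside elements decides in which of the two normal forms a family ends, and it is
  determined by the multiset union. So two families with the same union end in the same form.
\<close>

lemma relaxed_connected:
  assumes I: "finite I" and f: "\<forall>k\<in>I. f k \<in> relaxed" and g: "\<forall>k\<in>I. g k \<in> relaxed"
    and occ: "\<And>x. occ I f x = occ I g x" and off: "\<forall>k. k \<notin> I \<longrightarrow> f k = g k"
    and bases: "\<And>f' g'. \<lbrakk>\<forall>k\<in>I. f' k \<in> \<B>; \<forall>k\<in>I. g' k \<in> \<B>; \<And>x. occ I f' x = occ I g' x;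
       \<forall>k. k \<notin> I \<longrightarrow> f' k = f k \<and> g' k = f k\<rbrakk> \<Longrightarrow> (exch \<B> I)\<^sup>*\<^sup>* f' g'"
  shows "(exch relaxed I)\<^sup>*\<^sup>* f g"
proof -
  obtain f' where f': "(exch relaxed I)\<^sup>*\<^sup>* f f'"
    "(\<forall>k\<in>I. f' k \<in> \<B>) \<or> (\<exists>i\<in>I. f' i \<subseteq> H) \<and> (\<forall>k\<in>I. f' k \<in> thin)"
    using reduce_fully[OF I f] by blast
  obtain g' where g': "(exch relaxed I)\<^sup>*\<^sup>* g g'"
    "(\<forall>k\<in>I. g' k \<in> \<B>) \<or> (\<exists>i\<in>I. g' i \<subseteq> H) \<and> (\<forall>k\<in>I. g' k \<in> thin)"
    using reduce_fully[OF I g] by blast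
  have f'r: "\<forall>k\<in>I. f' k \<in> relaxed" and g'r: "\<forall>k\<in>I. g' k \<in> relaxed"
    using exch_members[OF f'(1) f] exch_members[OF g'(1) g] by blast+
  have occ': "occ I f' x = occ I g' x" for x
    using exch_occ[OF I f'(1)] exch_occ[OF I g'(1)] occ by simp
  have off': "\<forall>k. k \<notin> I \<longrightarrow> f' k = f k \<and> g' k = f k"
    using exch_outside[OF f'(1)] exch_outside[OF g'(1)] off by simp
  have weq: "n_outside I f' = n_outside I g'"
    using n_outside_occ[OF I, of f'] n_outside_occ[OF I, of g'] f'r g'r relaxed_sub occ' by simp
  have heavy_all: "card I \<le> n_outside I h" if "\<forall>k\<in>I. h k \<in> \<B>" for h
  proof -
    have "1 \<le> card (h k - H)" if "k \<in> I" for k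
      using \<open>\<forall>k\<in>I. h k \<in> \<B>\<close> that basis_out relaxed_finite bases_relaxed
      by (auto simp: Suc_le_eq card_gt_0_iff)
    then have "(\<Sum>k\<in>I. 1) \<le> n_outside I h" unfolding n_outside_def by (intro sum_mono)
    then show ?thesis by simp
  qed
  have light: "n_outside I h < card I" if h: "\<exists>i\<in>I. h i \<subseteq> H" "\<forall>k\<in>I. h k \<in> thin" for h
  proof -
    obtain i where i: "i \<in> I" "h i \<subseteq> H" using h(1) by blast
    then have c: "card (h i - H) = 0" by (metis Diff_eq_empty_iff card.empty)
    have "n_outside I h < (\<Sum>k\<in>I. 1)"
      unfolding n_outside_def
    proof (rule sum_strict_mono_ex1[OF I])
      show "\<forall>k\<in>I. card (h k - H) \<le> 1" using h(2) by (simp add: thin_def)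
      show "\<exists>k\<in>I. card (h k - H) < 1" using i(1) c by (intro bexI[of _ i]) simp_all
    qed
    then show ?thesis by simp
  qed
  have "(exch relaxed I)\<^sup>*\<^sup>* f' g'"
  proof (cases "(\<forall>k\<in>I. f' k \<in> \<B>) \<and> (\<forall>k\<in>I. g' k \<in> \<B>)")
    case True
    then have "(exch \<B> I)\<^sup>*\<^sup>* f' g'" using bases occ' off' by blast
    then show ?thesis by (rule exch_rtranclp_mono[OF bases_relaxed subset_refl])
  next
    case False
    have "\<not> (\<forall>k\<in>I. f' k \<in> \<B>)"
    proof
      assume fB: "\<forall>k\<in>I. f' k \<in> \<B>"
      then have "(\<exists>i\<in>I. g' i \<subseteq> H) \<and> (\<forall>k\<in>I. g' k \<in> thin)" using g'(2) False by blast
      then show False using light[of g'] heavy_all[OF fB] weq by simp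
    qed
    moreover have "\<not> (\<forall>k\<in>I. g' k \<in> \<B>)"
    proof
      assume gB: "\<forall>k\<in>I. g' k \<in> \<B>"
      then have "(\<exists>i\<in>I. f' i \<subseteq> H) \<and> (\<forall>k\<in>I. f' k \<in> thin)" using f'(2) False by blast
      then show False using light[of f'] heavy_all[OF gB] weq by simp
    qed
    ultimately have "(\<forall>k\<in>I. f' k \<in> thin) \<and> (\<forall>k\<in>I. g' k \<in> thin)"
      using f'(2) g'(2) by blast
    then have "(exch thin I)\<^sup>*\<^sup>* f' g'"
      using thin_connected[OF I _ _ occ'] off' by simp
    then show ?thesis by (rule exch_rtranclp_mono[OF thin_relaxed subset_refl])
  qed
  then show ?thesis
    by (rule rtranclp_trans[OF rtranclp_trans[OF f'(1)] exch_rtranclp_sym[OF g'(1)]])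
qed

section \<open>Exchanges that keep the number of new bases\<close>

definition below :: "'i set \<Rightarrow> nat \<Rightarrow> ('i \<Rightarrow> 'a set) \<Rightarrow> ('i \<Rightarrow> 'a set) \<Rightarrow> bool" where
  "below I k f g \<longleftrightarrow> exch relaxed I f g \<and> n_inside I f < k \<and> n_inside I g < k"

lemma bases_below:
  assumes "finite I" "(exch \<B> I)\<^sup>*\<^sup>* f g" "n_inside I f < k"
  shows "(below I k)\<^sup>*\<^sup>* f g \<and> n_inside I g < k"
  using assms(2)
proof induction
  case (step g h)
  then have "n_inside I h = n_inside I g" using exch_basis_n_inside assms(1) by blast
  with step have "below I k g h"
    by (auto simp: below_def intro: exch_mono[OF bases_relaxed subset_refl])
  with step show ?case using \<open>n_inside I h = n_inside I g\<close> by auto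
qed (simp add: assms)

text \<open>
  Linked families can be bypassed: some reductions of the two are joined by a path on which there are
  always fewer new bases than in \<open>f\<close>.
\<close>

definition linked :: "'i set \<Rightarrow> ('i \<Rightarrow> 'a set) \<Rightarrow> ('i \<Rightarrow> 'a set) \<Rightarrow> bool" where
  "linked I f g \<longleftrightarrow> (\<exists>i j a b i' j' a' b'.
     reducible I f i j a b \<and> reducible I g i' j' a' b' \<and>
     (below I (n_inside I f))\<^sup>*\<^sup>* (reduced f i j a b) (reduced g i' j' a' b'))"

lemma linkedI:
  assumes "finite I" "reducible I f i j a b" "reducible I g i' j' a' b'"
    and "(exch \<B> I)\<^sup>*\<^sup>* (reduced f i j a b) (reduced g i' j' a' b')"
  shows "linked I f g"
proof -
  have "n_inside I (reduced f i j a b) < n_inside I f"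
    using reducible_n_inside[OF assms(1,2)] by simp
  from bases_below[OF assms(1,4) this] show ?thesis
    unfolding linked_def using assms by blast
qed

text \<open>
  If a heavy set \<open>f j\<close> does not take part in the exchange of \<open>u\<close> and \<open>v\<close>, the new basis at \<open>i\<close> is
  reduced by means of \<open>f j\<close> before and after the exchange, and the two operations commute. If \<open>i\<close> itself takes
  part, the element leaving it in the reduction must be chosen different from \<open>u\<close>.
\<close>

lemma linked_far:
  assumes I: "finite I" and pq: "p \<in> I" "q \<in> I" "p \<noteq> q"
    and val: "f p \<in> relaxed" "f q \<in> relaxed" "f i \<in> relaxed"
    and uv: "u \<in> f p" "u \<notin> f q" "v \<in> f q" "v \<notin> f p"
    and g: "g = moved f p q u v" and gv: "g p \<in> relaxed" "g q \<in> relaxed"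
    and ng: "n_inside I g = n_inside I f"
    and i: "i \<in> I" "f i \<subseteq> H" "g i \<subseteq> H" "i \<noteq> q"
    and j: "j \<in> I" "j \<noteq> p" "j \<noteq> q" "f j \<in> \<B>" "b \<in> f j" "e \<in> f j" "b \<noteq> e" "b \<notin> H" "e \<notin> H"
  shows "linked I f g"
proof -
  have ci: "card (f i) = r" using val relaxed_card by blast
  have cgi: "card (g i) = r" using val gv relaxed_card g i by (cases "i = p") auto
  obtain a where a: "a \<in> f i" "a \<notin> f j" "a \<noteq> u" "insert a (f j - {b}) \<in> \<B>"
    using basis_exchange_relaxed[OF j(4,5,6,7,8,9) i(2) ci, of u] by auto
  have gj: "g j = f j" and ag: "a \<in> g i" using g j a i by auto
  have ij: "i \<noteq> j" using i j basis_out by blast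
  have bE: "b \<in> E" using j basis_sub by blast
  have rf: "reducible I f i j a b" and rg: "reducible I g i j a b"
    using i j a ci cgi gj ag by (auto simp: reducible_def)
  define F where "F = reduced f i j a b"
  define G where "G = reduced g i j a b"
  have bF: "insert b (f i - {a}) \<in> \<B>" and bG: "insert b (g i - {a}) \<in> \<B>"
    using reducible_basis[OF rf] reducible_basis[OF rg] by blast+
  have bp: "i = p \<Longrightarrow> b \<noteq> v \<and> b \<noteq> u" using i j g uv pq by auto
  have "exch relaxed I F G"
  proof -
    have Fp: "F p = (if i = p then insert b (f p - {a}) else f p)" "F q = f q"
      unfolding F_def reduced_def using ij j i by auto
    have Gp: "G p = insert v (F p - {u})" "G q = insert u (F q - {v})"
      unfolding G_def reduced_def Fp using ij j i pq g a bp uv by auto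
    have rel: "F p \<in> relaxed" "F q \<in> relaxed" "G p \<in> relaxed" "G q \<in> relaxed"
      unfolding F_def G_def reduced_def using ij j i pq gv val bF bG bases_relaxed by auto
    have "G = moved F p q u v"
      using Gp unfolding F_def G_def reduced_def g using j ij by (auto simp: fun_eq_iff)
    moreover have "exch relaxed I F (moved F p q u v)"
      by (rule exchI) (use pq rel Gp uv Fp a bp in auto)
    ultimately show ?thesis by simp
  qed
  then have "below I (n_inside I f) F G"
    using reducible_n_inside[OF I rf] reducible_n_inside[OF I rg] ng unfolding below_def F_def G_def
    by simp
  then show ?thesis unfolding linked_def F_def G_def using rf rg by blast
qed

text \<open>
  Here the new basis at \<open>p\<close> remains new, and is reduced by means of the very set \<open>f q\<close> with which
  it exchanges. Write \<open>f q = K + b + v\<close>. If \<open>K + u + v\<close> is a basis, then moving \<open>u\<close>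
  against \<open>b\<close> before the exchange and \<open>v\<close> against \<open>b\<close> after it give the same family. Otherwise some \<open>a\<close>
  makes \<open>K + v + a\<close> a basis, and then \<open>K + u + a\<close> is also one, so that moving \<open>a\<close> against \<open>b\<close> commutes with the exchange.
\<close>

lemma linked_near:
  assumes I: "finite I" and pq: "p \<in> I" "q \<in> I" "p \<noteq> q"
    and val: "f p \<in> relaxed" "f q \<in> \<B>"
    and uv: "u \<in> f p" "u \<notin> f q" "v \<in> f q" "v \<notin> f p"
    and g: "g = moved f p q u v" and gv: "g p \<in> relaxed" "g q \<in> \<B>"
    and new: "f p \<subseteq> H" "g p \<subseteq> H"
    and be: "b \<in> f q" "e \<in> f q" "b \<noteq> e" "b \<notin> H" "e \<notin> H"
  shows "linked I f g"
proof -
  define A where "A = f p"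
  define K where "K = f q - {v, b}"
  have A: "A \<subseteq> H" "card A = r" "u \<in> A" using new val relaxed_card uv by (auto simp: A_def)
  have gp: "g p = insert v (A - {u})" and gq: "g q = insert u (f q - {v})"
    using g pq by (auto simp: A_def)
  have vH: "v \<in> H" using new gp by auto
  have bE: "b \<in> E" using be val basis_sub by blast
  have cg: "card (g p) = r" using gv relaxed_card by blast
  have neq: "b \<noteq> v" "b \<noteq> u" "u \<noteq> v" "b \<notin> K" "v \<notin> K" "u \<notin> K" "b \<notin> A" "v \<notin> A"
    using be vH A uv by (auto simp: K_def A_def)
  have fq: "f q = insert b (insert v K)" and gq': "g q = insert b (insert u K)"
    using be uv neq gq by (auto simp: K_def)
  show ?thesis
  proof (cases "insert u (insert v K) \<in> \<B>")
    case True
    have 1: "f q - {b} = insert v K" and 2: "g q - {b} = insert u K" using fq gq' neq by auto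
    have rf: "reducible I f p q u b"
      using True 1 pq val new A uv be unfolding reducible_def A_def by auto
    have rg: "reducible I g p q v b"
      using True 2 pq gv new cg uv neq gp gq' be by (auto simp: reducible_def insert_commute)
    have "reduced f p q u b = reduced g p q v b"
      unfolding reduced_def 1 2 gp using g A neq by (auto simp: fun_eq_iff A_def)
    then show ?thesis using linkedI[OF I rf rg] by simp
  next
    case False
    obtain a where a: "a \<in> A" "a \<notin> f q" "a \<noteq> u" "insert a (f q - {b}) \<in> \<B>"
      using basis_exchange_relaxed[OF val(2) be A(1,2), of u] by auto
    have 1: "f q - {b} = insert v K" and 2: "g q - {b} = insert u K" using fq gq' neq by auto
    have an: "a \<noteq> b" "a \<noteq> v" "a \<notin> K" using a fq by auto
    have "b \<in> g q" "b \<notin> insert a (f q - {b})" using gq' an by auto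
    from exchange[OF gv(2) a(4) this]
    obtain y where y: "y \<in> insert a (f q - {b}) - g q" "insert y (g q - {b}) \<in> \<B>" by blast
    have "y = a \<or> y = v" using y(1) unfolding 1 gq' by blast
    moreover have "insert v (insert u K) \<notin> \<B>" using False by (simp add: insert_commute)
    ultimately have 3: "insert a (insert u K) \<in> \<B>"
      using y(2) unfolding 2 by metis
    have rf: "reducible I f p q a b"
      using pq val new A a be unfolding reducible_def A_def by auto
    have rg: "reducible I g p q a b"
      using 3 2 pq gv new cg a neq gp gq' an be by (auto simp: reducible_def)
    define S where "S = A - {a, u}"
    have S: "S \<subseteq> H" "Suc (Suc (card S)) = r" "a \<notin> S" "u \<notin> S" "v \<notin> S"
      using A a card_remove2[of A a u] neq by (auto simp: S_def)
    have uH: "u \<in> H" using A by auto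
    have "reduced f p q a b = f(p := insert u (insert b S), q := insert v (insert a K))"
      unfolding reduced_def 1 using a A by (auto simp: fun_eq_iff A_def S_def)
    moreover have "reduced g p q a b = f(p := insert v (insert b S), q := insert u (insert a K))"
    proof -
      have "insert b (g p - {a}) = insert v (insert b S)" using gp an by (auto simp: S_def)
      moreover have "insert a (insert u K) = insert u (insert a K)" by auto
      moreover have "g k = f k" if "k \<noteq> p" "k \<noteq> q" for k using g that by simp
      ultimately show ?thesis
        unfolding reduced_def 2 using pq(3) by (intro ext) simp
    qed
    moreover have "(exch \<B> I)\<^sup>*\<^sup>* (f(p := insert u (insert b S), q := insert v (insert a K)))
       (f(p := insert v (insert b S), q := insert u (insert a K)))"
    proof -
      have "insert u (insert b S) \<in> \<B>" "insert v (insert b S) \<in> \<B>"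
        using near_insert(1)[OF S(1,2)] S uH vH bE be by blast+
      moreover have "insert v (insert a K) \<in> \<B>" "insert u (insert a K) \<in> \<B>"
        using a(4) 3 unfolding 1 by (simp_all add: insert_commute)
      ultimately show ?thesis
        using exch_insert[of p I q "f(p := insert u (insert b S), q := insert v (insert a K))" u "insert b S" v "insert a K" \<B>]
          pq S(3-5) neq an a(3) by simp
    qed
    ultimately show ?thesis using linkedI[OF I rf rg] by simp
  qed
qed

text \<open>
  The exchange hands the role of the new basis from \<open>p\<close> to \<open>q\<close>, with the only outside element \<open>e\<close> of
  \<open>f q\<close> going to \<open>p\<close>. A third set \<open>f j\<close> supplies \<open>b\<close> for the reductions at \<open>p\<close> before, and at \<open>q\<close>
  after the exchange. Between the two reductions, \<open>b\<close> and \<open>e\<close> change places, then \<open>u\<close> and \<open>a'\<close>, and finally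
  \<open>a\<close> and \<open>a'\<close> between \<open>p\<close> and \<open>j\<close>.
\<close>

lemma linked_shift:
  assumes I: "finite I" and pq: "p \<in> I" "q \<in> I" "p \<noteq> q"
    and val: "f p \<in> relaxed" "f q \<in> \<B>"
    and uv: "u \<in> f p" "u \<notin> f q" "e \<in> f q" "e \<notin> f p"
    and g: "g = moved f p q u e" and gv: "g p \<in> \<B>" "g q \<in> relaxed"
    and new: "f p \<subseteq> H" "g q \<subseteq> H"
    and j: "j \<in> I" "j \<noteq> p" "j \<noteq> q" "f j \<in> \<B>" "b \<in> f j" "d \<in> f j" "b \<noteq> d" "b \<notin> H" "d \<notin> H"
  shows "linked I f g"
proof -
  define A where "A = f p"
  define L where "L = f q - {e}"
  define K where "K = f j - {b}"
  have A: "A \<subseteq> H" "card A = r" "u \<in> A" using new val relaxed_card uv by (auto simp: A_def)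
  have gp: "g p = insert e (A - {u})" and gq: "g q = insert u L" and gj: "g j = f j"
    using g pq j by (auto simp: A_def L_def)
  have fq: "f q = insert e L" using uv by (auto simp: L_def)
  have L: "L \<subseteq> H" "u \<notin> L" "e \<notin> L" using new gq uv by (auto simp: L_def)
  have eH: "e \<notin> H" using basis_out[OF val(2)] fq L by auto
  have bE: "b \<in> E" "e \<in> E" using basis_sub val j uv by blast+
  have cg: "card (g q) = r" using gv relaxed_card by blast
  have cL: "Suc (card L) = r" using cg gq L finite_subset[OF L(1) finite_H] by simp
  obtain a' where a': "a' \<in> L" "a' \<notin> f j" "insert a' K \<in> \<B>"
    using basis_exchange2[OF j(4-9) L(1) cL] by (auto simp: K_def)
  obtain a0 where a0: "a0 \<in> A" "a0 \<notin> f j" "a0 \<noteq> u" "insert a0 K \<in> \<B>"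
    using basis_exchange_relaxed[OF j(4-9) A(1,2), of u] by (auto simp: K_def)
  \<comment> \<open>This choice keeps \<open>a'\<close> out of the rest of \<open>A\<close>, so that \<open>a'\<close> can be moved to position \<open>p\<close>.\<close>
  define a where "a = (if a' \<in> A then a' else a0)"
  have a: "a \<in> A" "a \<notin> f j" "a \<noteq> u" "insert a K \<in> \<B>" "a' \<notin> A - {a}"
    using a0 a' L by (auto simp: a_def)
  have rf: "reducible I f p j a b" and rg: "reducible I g q j a' b"
    using pq j A a a' new cg gq gj by (auto simp: reducible_def A_def K_def)
  define S where "S = A - {a, u}"
  define L' where "L' = L - {a'}"
  have S: "S \<subseteq> H" "Suc (Suc (card S)) = r" "a \<notin> S" "u \<notin> S" "a' \<notin> S"
    using A a card_remove2[of A a u] by (auto simp: S_def)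
  have L': "L' \<subseteq> H" "Suc (Suc (card L')) = r" "u \<notin> L'" "a' \<notin> L'"
    using L a' cL finite_subset[OF L(1) finite_H] card_Suc_Diff1[of L a'] by (auto simp: L'_def)
  have H: "a \<in> H" "a' \<in> H" "u \<in> H" "a' \<noteq> u" using A a a' L by auto
  have K: "a \<notin> K" "a' \<notin> K" using a a' by (auto simp: K_def)
  have 1: "reduced f p j a b = f(p := insert b (insert u S), q := insert e (insert a' L'), j := insert a K)"
  proof -
    have "f p - {a} = insert u S" using a A by (auto simp: A_def S_def)
    moreover have "f q = insert e (insert a' L')" using fq a' by (auto simp: L'_def)
    ultimately show ?thesis
      unfolding reduced_def K_def using j(2,3) pq(3) by (intro ext) simp
  qed
  have 2: "reduced g q j a' b = f(p := insert a (insert e S), q := insert u (insert b L'), j := insert a' K)"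
  proof -
    have "g p = insert a (insert e S)" using a A gp by (auto simp: S_def)
    moreover have "insert b (g q - {a'}) = insert u (insert b L')" using gq H by (auto simp: L'_def)
    moreover have "g k = f k" if "k \<noteq> p" "k \<noteq> q" for k using g that by simp
    ultimately show ?thesis
      unfolding reduced_def gj K_def using j(2,3) pq(3) by (intro ext) simp
  qed
  have nin: "b \<notin> S" "e \<notin> S" "b \<notin> L'" "e \<notin> L'" "b \<noteq> u" "e \<noteq> u" "b \<noteq> a'" "e \<noteq> a'" "b \<noteq> a" "e \<noteq> a"
    using S L' H j eH by auto
  have m: "insert x (insert y S) \<in> \<B>" "insert y (insert x S) \<in> \<B>"
    if "x \<in> {a, a', u}" "y \<in> {b, e}" for x y
    using that near_insert[OF S(1,2)] S H bE j(8) eH by auto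
  have m': "insert x (insert y L') \<in> \<B>" "insert y (insert x L') \<in> \<B>"
    if "x \<in> {a', u}" "y \<in> {b, e}" for x y
    using that near_insert[OF L'(1,2)] L' H bE j(8) eH by auto
  have s1: "(exch \<B> I)\<^sup>*\<^sup>* (f(p := insert b (insert u S), q := insert e (insert a' L'), j := insert a K))
      (f(p := insert e (insert u S), q := insert b (insert a' L'), j := insert a K))"
    by (rule exch_12) (use pq j(1-3) nin S L' H m m' in simp_all)
  have s2: "(exch \<B> I)\<^sup>*\<^sup>* (f(p := insert u (insert e S), q := insert a' (insert b L'), j := insert a K))
      (f(p := insert a' (insert e S), q := insert u (insert b L'), j := insert a K))"
    by (rule exch_12) (use pq j(1-3) nin S L' H m m' in simp_all)
  have s3: "(exch \<B> I)\<^sup>*\<^sup>* (f(p := insert a' (insert e S), q := insert u (insert b L'), j := insert a K))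
      (f(p := insert a (insert e S), q := insert u (insert b L'), j := insert a' K))"
    by (rule exch_13) (use pq j(1-3) nin S L' H m m' K a(4) a'(3) in simp_all)
  have s1': "(exch \<B> I)\<^sup>*\<^sup>* (f(p := insert b (insert u S), q := insert e (insert a' L'), j := insert a K))
      (f(p := insert u (insert e S), q := insert a' (insert b L'), j := insert a K))"
    using s1 insert_commute[of e u S] insert_commute[of b a' L'] by metis
  have "(exch \<B> I)\<^sup>*\<^sup>* (reduced f p j a b) (reduced g q j a' b)"
    unfolding 1 2 by (rule rtranclp_trans[OF rtranclp_trans[OF s1' s2] s3])
  then show ?thesis by (rule linkedI[OF I rf rg])
qed

text \<open>
  Two elements \<open>u\<close>, \<open>v\<close> of \<open>H\<close> are exchanged between members of \<open>\<B>\<close>, and the new basis \<open>A\<close> at \<open>i\<close> is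
  reduced by means of the first of them, \<open>f p = K + u + b\<close>. If some \<open>a\<close> in \<open>A\<close> extends both \<open>K + u\<close>
  and \<open>K + v\<close> to bases, the reduction by \<open>a\<close> and \<open>b\<close> commutes with the exchange. Otherwise, in the rank two
  contraction by \<open>K\<close>, every element of \<open>A\<close> that is not a loop is parallel to \<open>u\<close> or to \<open>v\<close>, and these
  two are independent. Then one reduces with \<open>a\<close> parallel to \<open>v\<close> before, and with \<open>a'\<close> parallel to \<open>u\<close> after the
  exchange, and passes from one reduction to the other through the basis \<open>K + a + a'\<close>.
\<close>

lemma linked_old_inside:
  assumes I: "finite I" and pq: "p \<in> I" "q \<in> I" "p \<noteq> q"
    and val: "f p \<in> \<B>" "f q \<in> \<B>"
    and uv: "u \<in> f p" "u \<notin> f q" "v \<in> f q" "v \<notin> f p"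
    and g: "g = moved f p q u v" and gv: "g p \<in> \<B>" "g q \<in> \<B>"
    and i: "i \<in> I" "i \<noteq> p" "i \<noteq> q" "f i \<subseteq> H" "f i \<in> relaxed"
    and uvH: "u \<in> H" "v \<in> H"
    and be: "b \<in> f p" "e \<in> f p" "b \<noteq> e" "b \<notin> H" "e \<notin> H"
  shows "linked I f g"
proof -
  define A where "A = f i"
  define K where "K = f p - {u, b}"
  define T where "T = f q - {v}"
  have A: "A \<subseteq> H" "card A = r" using i relaxed_card by (auto simp: A_def)
  have gi: "g i = A" using g i by (simp add: A_def)
  have bE: "b \<in> E" using basis_sub val(1) be(1) by blast
  have fp: "f p = insert b (insert u K)" using be uv uvH by (auto simp: K_def)
  have fq: "f q = insert v T" using uv by (auto simp: T_def)
  have gp: "g p = insert b (insert v K)" proof -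
    have "g p = insert v (f p - {u})" using g pq(3) by simp
    then show ?thesis using be uvH by (auto simp: K_def)
  qed
  have gq: "g q = insert u T" using g pq by (simp add: T_def)
  have ne: "b \<noteq> u" "b \<noteq> v" "u \<noteq> v" "b \<notin> K" "u \<notin> K" "v \<notin> K" "u \<notin> T" "v \<notin> T" "b \<notin> A"
    using be uvH uv A by (auto simp: K_def T_def)
  have fpb: "f p - {b} = insert u K" and gpb: "g p - {b} = insert v K"
    using fp gp ne by auto
  have eg: "e \<in> g p" "b \<in> g p" using be uvH fp gp by auto
  have frest: "g k = f k" if "k \<noteq> p" "k \<noteq> q" for k using g that by simp
  have f3: "reduced f i p a b = f(i := insert b (A - {a}), p := insert a (insert u K), q := insert v T)" for a
    unfolding reduced_def fpb A_def using i(2,3) pq(3) fq by (intro ext) simp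
  have g3: "reduced g i p a b = f(i := insert b (A - {a}), p := insert a (insert v K), q := insert u T)" for a
    unfolding reduced_def gpb gi using i(2,3) pq(3) gq frest by (intro ext) simp
  have rf: "reducible I f i p a b" if "a \<in> A" "a \<notin> f p" "insert a (insert u K) \<in> \<B>" for a
    unfolding reducible_def fpb using that i(1,4) A(2) pq(1) val(1) be(1,4) unfolding A_def by simp
  have rg: "reducible I g i p a b" if "a \<in> A" "a \<notin> g p" "insert a (insert v K) \<in> \<B>" for a
    unfolding reducible_def gpb gi using that i(1) A pq(1) gv(1) eg be(4) by simp
  show ?thesis
  proof (cases "\<exists>a\<in>A. a \<notin> f p \<and> a \<noteq> v \<and> insert a (insert u K) \<in> \<B> \<and> insert a (insert v K) \<in> \<B>")
    case True
    then obtain a where a: "a \<in> A" "a \<notin> f p" "a \<noteq> v" "insert a (insert u K) \<in> \<B>" "insert a (insert v K) \<in> \<B>"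
      by blast
    have ag: "a \<notin> g p" and an: "a \<noteq> u" "a \<noteq> b" "a \<notin> K" using a fp gp by auto
    have "(exch \<B> I)\<^sup>*\<^sup>* (reduced f i p a b) (reduced g i p a b)"
      unfolding f3 g3 insert_commute[of a u] insert_commute[of a v]
      by (rule exch_23)
        (use pq i a(3,4,5) an ne val(2) gv(2) fq gq in \<open>simp_all add: insert_commute\<close>)
    then show ?thesis by (rule linkedI[OF I rf[OF a(1,2,4)] rg[OF a(1) ag a(5)]])
  next
    case False
    obtain a0 where a0: "a0 \<in> A" "a0 \<notin> f p" "insert a0 (insert u K) \<in> \<B>"
      using basis_exchange_relaxed[OF val(1) be A, of u] unfolding fpb by blast
    obtain a1 where a1: "a1 \<in> A" "a1 \<notin> g p" "insert a1 (insert v K) \<in> \<B>"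
      using basis_exchange_relaxed[OF gv(1) eg(2,1) be(3,4,5) A, of u] unfolding gpb by blast
    have vu: "insert v (insert u K) \<in> \<B>"
    proof (cases "a0 = v")
      case True
      then show ?thesis using a0 by simp
    next
      case neq: False
      have no: "insert a0 (insert v K) \<notin> \<B>" using False a0 neq by blast
      have "b \<in> g p" "b \<notin> insert a0 (insert u K)" using a0 fp gp ne by auto
      from exchange[OF gv(1) a0(3) this]
      obtain y where y: "y \<in> insert a0 (insert u K) - g p" "insert y (g p - {b}) \<in> \<B>" by blast
      have "y = a0 \<or> y = u" using y(1) unfolding gp by blast
      then show ?thesis using y(2) no unfolding gpb by (metis insert_commute)
    qed
    \<comment> \<open>If \<open>v\<close> or \<open>u\<close> lies in \<open>A\<close>, it is chosen itself, which makes one of the steps below trivial.\<close>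
    define a where "a = (if v \<in> A then v else a0)"
    define a' where "a' = (if u \<in> A then u else a1)"
    have a: "a \<in> A" "a \<notin> f p" "insert a (insert u K) \<in> \<B>" "v \<notin> A - {a}"
      using a0 vu uv by (auto simp: a_def)
    have a': "a' \<in> A" "a' \<notin> g p" "insert a' (insert v K) \<in> \<B>" "u \<notin> A - {a'}"
      using a1 vu ne gp by (auto simp: a'_def insert_commute)
    have an: "a \<noteq> u" "a \<noteq> b" "a \<notin> K" using a(2) fp by auto
    have an': "a' \<noteq> v" "a' \<noteq> b" "a' \<notin> K" using a'(2) gp by auto
    have aa': "a \<noteq> a'" using False a a' an' by metis
    have K: "insert a (insert a' K) \<in> \<B>"
    proof (cases "a = v \<or> a' = u")
      case True
      then show ?thesis using a(3) a'(3) by (auto simp: insert_commute)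
    next
      case neq: False
      have no: "insert v (insert a K) \<notin> \<B>" using False a(1-3) neq insert_commute by metis
      have "u \<in> insert a (insert u K)" "u \<notin> insert a' (insert v K)" using ne neq by auto
      from exchange[OF a(3) a'(3) this]
      obtain y where y: "y \<in> insert a' (insert v K) - insert a (insert u K)"
        "insert y (insert a (insert u K) - {u}) \<in> \<B>" by blast
      have "insert a (insert u K) - {u} = insert a K" using ne an by auto
      moreover have "y = a' \<or> y = v" using y(1) by blast
      ultimately show ?thesis using y(2) no by (metis insert_commute)
    qed
    define S where "S = A - {a, a'}"
    have S: "S \<subseteq> H" "Suc (Suc (card S)) = r" "u \<notin> S" "v \<notin> S" "a \<notin> S" "a' \<notin> S" "b \<notin> S"
      using A card_remove2[OF A a(1) a'(1) aa'] a(4) a'(4) ne by (auto simp: S_def)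
    have m: "insert x (insert b S) \<in> \<B>" if "x \<in> {u, v, a, a'}" for x
      using near_insert(1)[OF S(1,2) _ _ bE be(4)] that S uvH A a(1) a'(1) by blast
    have B2: "insert u (insert a K) \<in> \<B>" "insert v (insert a' K) \<in> \<B>" "insert a' (insert a K) \<in> \<B>"
      using a(3) a'(3) K by (simp_all add: insert_commute)
    have iA: "insert b (A - {a}) = insert a' (insert b S)" "insert b (A - {a'}) = insert a (insert b S)"
      using a(1) a'(1) aa' by (auto simp: S_def)
    have s1: "(exch \<B> I)\<^sup>*\<^sup>* (f(i := insert a' (insert b S), p := insert u (insert a K), q := insert v T))
       (f(i := insert u (insert b S), p := insert a' (insert a K), q := insert v T))"
      by (rule exch_12)
        (use pq i(1-3) an an' ne aa' S m B2 K in simp_all)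
    have s2: "(exch \<B> I)\<^sup>*\<^sup>* (f(i := insert u (insert b S), p := insert a (insert a' K), q := insert v T))
       (f(i := insert v (insert b S), p := insert a (insert a' K), q := insert u T))"
      by (rule exch_13)
        (use pq i(1-3) ne S m val(2) gv(2) fq gq in simp_all)
    have s3: "(exch \<B> I)\<^sup>*\<^sup>* (f(i := insert v (insert b S), p := insert a (insert a' K), q := insert u T))
       (f(i := insert a (insert b S), p := insert v (insert a' K), q := insert u T))"
      by (rule exch_12)
        (use pq i(1-3) an an' ne aa' S m B2 K in simp_all)
    have "(exch \<B> I)\<^sup>*\<^sup>* (reduced f i p a b) (reduced g i p a' b)"
      unfolding f3 g3 iA insert_commute[of a u] insert_commute[of a' v]
      by (rule rtranclp_trans[OF s1, unfolded insert_commute[of a' a], OF rtranclp_trans[OF s2 s3]])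
    then show ?thesis by (rule linkedI[OF I rf[OF a(1-3)] rg[OF a'(1-3)]])
  qed
qed

text \<open>
  Two outside elements \<open>u\<close>, \<open>v\<close> are exchanged. Reducing by \<open>u\<close> before and by \<open>v\<close> after the exchange, with the
  same \<open>a\<close> from the new basis, leaves the same set at \<open>p\<close>; the exchange then takes place between \<open>i\<close>
  and \<open>q\<close>.
\<close>

lemma linked_old_outside:
  assumes I: "finite I" and pq: "p \<in> I" "q \<in> I" "p \<noteq> q"
    and val: "f p \<in> \<B>" "f q \<in> \<B>"
    and uv: "u \<in> f p" "u \<notin> f q" "v \<in> f q" "v \<notin> f p"
    and g: "g = moved f p q u v" and gv: "g p \<in> \<B>" "g q \<in> \<B>"
    and i: "i \<in> I" "i \<noteq> p" "i \<noteq> q" "f i \<subseteq> H" "f i \<in> relaxed"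
    and uvH: "u \<notin> H" "v \<notin> H"
    and e: "e \<in> f p" "u \<noteq> e" "e \<notin> H"
  shows "linked I f g"
proof -
  define A where "A = f i"
  define K where "K = f p - {u}"
  define T where "T = f q - {v}"
  have A: "A \<subseteq> H" "card A = r" using i relaxed_card by (auto simp: A_def)
  have gi: "g i = A" using g i by (simp add: A_def)
  have E: "u \<in> E" "v \<in> E" using basis_sub val uv by blast+
  have fq: "f q = insert v T" using uv by (auto simp: T_def)
  have gp: "g p = insert v K" and gq: "g q = insert u T" using g pq by (simp_all add: T_def K_def)
  have ne: "u \<noteq> v" "u \<notin> K" "v \<notin> K" "u \<notin> T" "v \<notin> T" "u \<notin> A" "v \<notin> A"
    using uvH uv A by (auto simp: K_def T_def)
  have gpv: "g p - {v} = K" using gp ne by simp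
  have frest: "g k = f k" if "k \<noteq> p" "k \<noteq> q" for k using g that by simp
  obtain a where a: "a \<in> A" "a \<notin> f p" "insert a K \<in> \<B>"
    using basis_exchange_relaxed[OF val(1) uv(1) e(1,2) uvH(1) e(3) A, of u] unfolding K_def by blast
  have ag: "a \<notin> g p" using a gp ne by (auto simp: K_def)
  have rf: "reducible I f i p a u"
    unfolding reducible_def using a A i(1,4) pq(1) val(1) uv(1) uvH unfolding A_def K_def by simp
  have rg: "reducible I g i p a v"
    unfolding reducible_def gpv gi using a ag A i(1) pq(1) gv(1) gp uvH by simp
  have f3: "reduced f i p a u = f(i := insert u (A - {a}), p := insert a K, q := insert v T)"
    unfolding reduced_def A_def K_def using i(2,3) pq(3) fq by (intro ext) simp
  have g3: "reduced g i p a v = f(i := insert v (A - {a}), p := insert a K, q := insert u T)"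
    unfolding reduced_def gpv gi using i(2,3) pq(3) gq frest by (intro ext) simp
  have m: "insert u (A - {a}) \<in> \<B>" "insert v (A - {a}) \<in> \<B>"
    using near_remove A a(1) E uvH by blast+
  have "(exch \<B> I)\<^sup>*\<^sup>* (reduced f i p a u) (reduced g i p a v)"
    unfolding f3 g3
    by (rule exch_13) (use pq i(1-3) ne m val(2) gv(2) fq gq in simp_all)
  then show ?thesis by (rule linkedI[OF I rf rg])
qed

text \<open>
  An element \<open>u\<close> of \<open>H\<close> is exchanged for an outside element \<open>v\<close>. The set that contains \<open>v\<close> is heavy, namely
  \<open>f q\<close> before and \<open>g p\<close> after the exchange, so \<open>v\<close> can be given to the new basis in both
  reductions. The remaining elements \<open>u\<close>, \<open>a\<close>, \<open>a'\<close> are then permuted among the three positions.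
\<close>

lemma linked_old_mixed:
  assumes I: "finite I" and pq: "p \<in> I" "q \<in> I" "p \<noteq> q"
    and val: "f p \<in> \<B>" "f q \<in> \<B>"
    and uv: "u \<in> f p" "u \<notin> f q" "v \<in> f q" "v \<notin> f p"
    and g: "g = moved f p q u v" and gv: "g p \<in> \<B>" "g q \<in> \<B>"
    and i: "i \<in> I" "i \<noteq> p" "i \<noteq> q" "f i \<subseteq> H" "f i \<in> relaxed"
    and uvH: "u \<in> H" "v \<notin> H"
  shows "linked I f g"
proof -
  define A where "A = f i"
  define K where "K = f p - {u}"
  define L where "L = f q - {v}"
  have A: "A \<subseteq> H" "card A = r" using i relaxed_card by (auto simp: A_def)
  have gi: "g i = A" using g i by (simp add: A_def)
  have E: "v \<in> E" using basis_sub val uv by blast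
  have fp: "f p = insert u K" and fq: "f q = insert v L" using uv by (auto simp: K_def L_def)
  have gp: "g p = insert v K" and gq: "g q = insert u L" using g pq by (simp_all add: L_def K_def)
  have ne: "u \<noteq> v" "u \<notin> K" "v \<notin> K" "u \<notin> L" "v \<notin> L" "v \<notin> A"
    using uvH uv A by (auto simp: K_def L_def)
  have gpv: "g p - {v} = K" using gp ne by simp
  have fqv: "f q - {v} = L" by (simp add: L_def)
  have frest: "g k = f k" if "k \<noteq> p" "k \<noteq> q" for k using g that by simp
  have rf: "reducible I f i q a v" if "a \<in> A" "a \<notin> f q" "insert a L \<in> \<B>" for a
    unfolding reducible_def fqv using that A i(1,4) pq val uv uvH unfolding A_def by simp
  have rg: "reducible I g i p a v" if "a \<in> A" "a \<notin> g p" "insert a K \<in> \<B>" for a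
    unfolding reducible_def gpv gi using that A i(1) pq(1) gv(1) gp uvH by simp
  have f3: "reduced f i q a v = f(i := insert v (A - {a}), p := insert u K, q := insert a L)" for a
    unfolding reduced_def A_def fqv using i(2,3) pq(3) fp by (intro ext) simp
  have g3: "reduced g i p a v = f(i := insert v (A - {a}), p := insert a K, q := insert u L)" for a
    unfolding reduced_def gpv gi using i(2,3) pq(3) gq frest by (intro ext) simp
  show ?thesis
  proof (cases "u \<in> A")
    case True
    have 1: "u \<notin> g p" using gp ne by simp
    have "(exch \<B> I)\<^sup>*\<^sup>* (reduced f i q u v) (reduced g i p u v)"
      unfolding f3 g3 by simp
    moreover have "insert u L \<in> \<B>" "insert u K \<in> \<B>" using gv(2) gq val(1) fp by simp_all
    ultimately show ?thesis using linkedI[OF I rf[OF True uv(2)] rg[OF True 1]] by blast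
  next
    case False
    obtain e1 where e1: "e1 \<in> K" "e1 \<notin> H" using basis_out[OF val(1)] fp uvH by auto
    obtain e2 where e2: "e2 \<in> L" "e2 \<notin> H" using basis_out[OF gv(2)] gq uvH by auto
    have e: "e1 \<in> g p" "v \<noteq> e1" "v \<in> g p" "e2 \<in> f q" "v \<noteq> e2"
      using e1 e2 gp fq ne by auto
    obtain a where a: "a \<in> A" "a \<notin> f q" "insert a L \<in> \<B>"
      using basis_exchange_relaxed[OF val(2) uv(3) e(4,5) uvH(2) e2(2) A, of u] unfolding fqv by blast
    obtain a' where a': "a' \<in> A" "a' \<notin> g p" "insert a' K \<in> \<B>"
      using basis_exchange_relaxed[OF gv(1) e(3,1,2) uvH(2) e1(2) A, of u] unfolding gpv by blast
    have an: "a \<noteq> u" "a' \<noteq> u" "a \<notin> L" "a' \<notin> K" using a a' False fq gp by auto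
    have mem: "insert u L \<in> \<B>" "insert u K \<in> \<B>" using gv(2) gq val(1) fp by simp_all
    have "(exch \<B> I)\<^sup>*\<^sup>* (reduced f i q a v) (reduced g i p a' v)"
    proof (cases "a = a'")
      case True
      show ?thesis unfolding f3 g3 True
        by (rule exch_23) (use pq i(1-3) ne an True a a' mem in simp_all)
    next
      case neq: False
      define S where "S = A - {a, a'}"
      have S: "S \<subseteq> H" "Suc (Suc (card S)) = r" "u \<notin> S" "a \<notin> S" "a' \<notin> S" "v \<notin> S"
        using A card_remove2[OF A a(1) a'(1) neq] False ne by (auto simp: S_def)
      have m: "insert x (insert v S) \<in> \<B>" if "x \<in> {u, a, a'}" for x
        using near_insert(1)[OF S(1,2) _ _ E uvH(2)] that S uvH A a(1) a'(1) by blast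
      have iA: "insert v (A - {a}) = insert a' (insert v S)" "insert v (A - {a'}) = insert a (insert v S)"
        using a(1) a'(1) neq by (auto simp: S_def)
      have nv: "a \<noteq> v" "a' \<noteq> v" using a a' ne by auto
      have s1: "(exch \<B> I)\<^sup>*\<^sup>* (f(i := insert a' (insert v S), p := insert u K, q := insert a L))
         (f(i := insert u (insert v S), p := insert a' K, q := insert a L))"
        by (rule exch_12) (use pq i(1-3) an ne nv S m a' mem in simp_all)
      have s2: "(exch \<B> I)\<^sup>*\<^sup>* (f(i := insert u (insert v S), p := insert a' K, q := insert a L))
         (f(i := insert a (insert v S), p := insert a' K, q := insert u L))"
        by (rule exch_13) (use pq i(1-3) an ne nv S m a mem in simp_all)
      show ?thesis unfolding f3 g3 iA by (rule rtranclp_trans[OF s1 s2])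
    qed
    then show ?thesis by (rule linkedI[OF I rf[OF a] rg[OF a']])
  qed
qed

lemma exch_pair_n_inside:
  assumes "finite I" "p \<in> I" "q \<in> I" "p \<noteq> q" "g = f(p := A, q := B)"
  shows "n_inside I g + of_bool (f p \<subseteq> H) + of_bool (f q \<subseteq> H) = n_inside I f + of_bool (A \<subseteq> H) + of_bool (B \<subseteq> H)"
  unfolding assms(5) n_inside_def using sum_upd2[OF assms(1-4), of "\<lambda>B. of_bool (B \<subseteq> H)"] by blast

text \<open>
  A heavy set exists because there is a new basis but at least as many outside elements as
  positions. The cases are distinguished by the place of this set, by the new bases among the sets that take part,
  and, if there are none, by the side of \<open>H\<close> on which the exchanged elements lie.
\<close>

lemma linked_plateau:
  assumes I: "finite I" and val: "\<forall>k\<in>I. f k \<in> relaxed" and w: "card I \<le> n_outside I f"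
    and fg: "exch relaxed I f g" and ng: "n_inside I g = n_inside I f" "0 < n_inside I f"
  shows "linked I f g"
proof -
  have "\<exists>i\<in>I. f i \<subseteq> H"
    using ng(2) unfolding n_inside_def by (rule contrapos_pp) simp
  then obtain i where i: "i \<in> I" "f i \<subseteq> H" by blast
  then obtain j where j: "j \<in> I" "heavy (f j)"
    using heavy_exists[OF I val] w by blast
  then obtain b e where be: "b \<in> f j" "e \<in> f j" "b \<noteq> e" "b \<notin> H" "e \<notin> H"
    by (auto simp: heavy_def)
  have J: "f j \<in> \<B>" using relaxed_basis heavy_not_inside val j by blast
  define P where "P p q u v \<longleftrightarrow> p \<in> I \<and> q \<in> I \<and> p \<noteq> q \<and> u \<in> f p \<and> u \<notin> f q \<and> v \<in> f q \<and> v \<notin> f p \<and>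
     g = moved f p q u v \<and> g p \<in> relaxed \<and> g q \<in> relaxed" for p q u v
  have P_sym: "P q p v u" if "P p q u v" for p q u v
    using that unfolding P_def by (auto simp: fun_upd_twist)
  have P_new: "of_bool (g p \<subseteq> H) + of_bool (g q \<subseteq> H) = (of_bool (f p \<subseteq> H) + of_bool (f q \<subseteq> H) :: nat)"
    and P_p: "g p = insert v (f p - {u})" and P_q: "g q = insert u (f q - {v})"
    if "P p q u v" for p q u v
  proof -
    have pq: "p \<in> I" "q \<in> I" "p \<noteq> q" "g = moved f p q u v" using that unfolding P_def by blast+
    show 1: "g p = insert v (f p - {u})" and 2: "g q = insert u (f q - {v})" using pq by simp_all
    show "of_bool (g p \<subseteq> H) + of_bool (g q \<subseteq> H) = (of_bool (f p \<subseteq> H) + of_bool (f q \<subseteq> H) :: nat)"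
      unfolding 1 2 using exch_pair_n_inside[OF I pq] ng(1) by linarith
  qed
  have main: "linked I f g" if pq: "P p q u v" and p: "f p \<subseteq> H" for p q u v
  proof -
    note pq' = pq[unfolded P_def]
    have jp: "j \<noteq> p" using j(2) heavy_not_inside p by blast
    show ?thesis
    proof (cases "g p \<subseteq> H")
      case True
      show ?thesis
      proof (cases "j = q")
        case False
        show ?thesis
          by (rule linked_far[where p = p and q = q and i = p and j = j and u = u and v = v and b = b and e = e])
            (use I pq' val ng(1) p True j(1) jp False J be in auto)
      next
        case jq: True
        have "g q \<in> \<B>"
        proof (rule relaxed_basis)
          show "\<not> g q \<subseteq> H" using P_new[OF pq] True p heavy_not_inside[OF j(2)] jq by auto
        qed (use pq' in blast)
        then show ?thesis
          by (intro linked_near[where p = p and q = q and u = u and v = v and b = b and e = e])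
            (use I pq' val p True J be jq in auto)
      qed
    next
      case False
      then have gp: "g p \<in> \<B>" using relaxed_basis pq' by blast
      have q: "\<not> f q \<subseteq> H" "g q \<subseteq> H"
        using P_new[OF pq] False p P_p[OF pq] pq' by (auto split: if_splits simp: of_bool_def)
      then have fq: "f q \<in> \<B>" using relaxed_basis pq' val by blast
      have jq: "j \<noteq> q"
      proof
        assume "j = q"
        then have "b = v" "e = v" using P_q[OF pq] q be by auto
        then show False using be by blast
      qed
      show ?thesis
        by (rule linked_shift[where p = p and q = q and j = j and u = u and e = v and b = b and d = e])
          (use I pq' val p q fq gp j(1) jq jp J be in auto)
    qed
  qed
  obtain p q u v where pq: "P p q u v"
    using fg
  proof (cases rule: exchE)
    case (1 p q a b)
    then show ?thesis by (intro that[of p q a b]) (auto simp: P_def)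
  qed
  note pq' = pq[unfolded P_def]
  show ?thesis
  proof (cases "f p \<subseteq> H \<or> f q \<subseteq> H")
    case True
    then show ?thesis using main pq P_sym by blast
  next
    case False
    then have fB: "f p \<in> \<B>" "f q \<in> \<B>" using relaxed_basis val pq' by blast+
    have "\<not> g p \<subseteq> H" "\<not> g q \<subseteq> H" using P_new[OF pq] False by auto
    then have gB: "g p \<in> \<B>" "g q \<in> \<B>" using relaxed_basis pq' by blast+
    have ipq: "i \<noteq> p" "i \<noteq> q" using i False by blast+
    have gi: "g i = f i" using pq' ipq by simp
    have old: "linked I f g" if pq: "P p q u v" and jp: "j = p"
      and B: "f p \<in> \<B>" "f q \<in> \<B>" "g p \<in> \<B>" "g q \<in> \<B>" and ipq: "i \<noteq> p" "i \<noteq> q"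
      and same: "u \<in> H \<longleftrightarrow> v \<in> H" for p q u v
    proof -
      note pq' = pq[unfolded P_def]
      show ?thesis
      proof (cases "u \<in> H")
        case True
        then show ?thesis
          by (intro linked_old_inside[where p = p and q = q and i = i and u = u and v = v and b = b and e = e])
            (use I pq' val i ipq be jp B same in auto)
      next
        case False
        obtain e' where "e' \<in> f p" "u \<noteq> e'" "e' \<notin> H" using be jp by blast
        with False show ?thesis
          by (intro linked_old_outside[where p = p and q = q and i = i and u = u and v = v and e = e'])
            (use I pq' val i ipq jp B same in auto)
      qed
    qed
    consider "u \<in> H" "v \<notin> H" | "u \<notin> H" "v \<in> H" | "u \<in> H \<longleftrightarrow> v \<in> H" by blast
    then show ?thesis
    proof cases
      case 1
      then show ?thesis
        by (intro linked_old_mixed[where p = p and q = q and i = i and u = u and v = v])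
          (use I pq' val i ipq fB gB in auto)
    next
      case 2
      then show ?thesis
        by (intro linked_old_mixed[where p = q and q = p and i = i and u = v and v = u])
          (use I P_sym[OF pq, unfolded P_def] val i ipq fB gB in auto)
    next
      case 3
      show ?thesis
      proof (cases "j = p \<or> j = q")
        case True
        then show ?thesis using old[OF pq] old[OF P_sym[OF pq]] fB gB ipq 3 by blast
      next
        case False
        then show ?thesis
          by (intro linked_far[where p = p and q = q and i = i and j = j and u = u and v = v and b = b and e = e])
            (use I pq' val ng(1) i ipq gi j(1) J be in auto)
      qed
    qed
  qed
qed

text \<open>
  Two new bases that exchange remain new, so an exchange can only lower the number of new bases
  if exactly one of its sets is new and both become members of \<open>\<B>\<close>.
\<close>

lemma decreasing_exch_reduced:
  assumes I: "finite I" and fg: "exch relaxed I f g" and less: "n_inside I g < n_inside I f"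
  shows "\<exists>i j a b. reducible I f i j a b \<and> g = reduced f i j a b"
  using fg
proof (cases rule: exchE)
  case (1 p q a b)
  have n: "of_bool (insert b (f p - {a}) \<subseteq> H) + of_bool (insert a (f q - {b}) \<subseteq> H)
      < (of_bool (f p \<subseteq> H) + of_bool (f q \<subseteq> H) :: nat)"
    using exch_pair_n_inside[OF I 1(1-3,12)] less by linarith
  have red: "reducible I f p q a b" if "f p \<subseteq> H" "p \<in> I" "q \<in> I" "f p \<in> relaxed" "f q \<in> relaxed"
     "a \<in> f p" "a \<notin> f q" "b \<in> f q" "insert a (f q - {b}) \<in> relaxed" "b \<notin> H"
     "\<not> insert a (f q - {b}) \<subseteq> H" for p q a b
    unfolding reducible_def using that relaxed_basis relaxed_card by blast
  consider "f p \<subseteq> H" "f q \<subseteq> H" | "f p \<subseteq> H" "\<not> f q \<subseteq> H" | "\<not> f p \<subseteq> H" "f q \<subseteq> H"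
    | "\<not> f p \<subseteq> H" "\<not> f q \<subseteq> H" by blast
  then show ?thesis
  proof cases
    case c: 1
    then have "insert b (f p - {a}) \<subseteq> H" "insert a (f q - {b}) \<subseteq> H" using 1 by auto
    then show ?thesis using n c by simp
  next
    case c: 2
    then have nn: "\<not> insert b (f p - {a}) \<subseteq> H" "\<not> insert a (f q - {b}) \<subseteq> H"
      using n by (auto simp: of_bool_def split: if_splits)
    then have "b \<notin> H" using c by auto
    then have "reducible I f p q a b" using red[of p q a b] 1 c nn by blast
    then show ?thesis using 1(12) unfolding reduced_def by blast
  next
    case c: 3
    then have nn: "\<not> insert b (f p - {a}) \<subseteq> H" "\<not> insert a (f q - {b}) \<subseteq> H"
      using n by (auto simp: of_bool_def split: if_splits)
    then have "a \<notin> H" using c by auto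
    then have "reducible I f q p b a" using red[of q p b a] 1 c nn by blast
    moreover have "g = reduced f q p b a"
      unfolding 1(12) reduced_def using 1(3) by (simp add: fun_upd_twist)
    ultimately show ?thesis by blast
  next
    case 4
    then show ?thesis using n by simp
  qed
qed

section \<open>Reductions of one family\<close>

text \<open>
  In the contraction by \<open>K = J - {b, b'}\<close> of rank two, \<open>a\<close> should not be parallel to \<open>b'\<close>, \<open>a'\<close> not
  to \<open>b\<close>, and \<open>a\<close>, \<open>a'\<close> not to each other. If this fails with \<open>a'\<close> parallel to \<open>b\<close>, then \<open>a'\<close> may
  replace \<open>b\<close> in \<open>J\<close>, and the roles of \<open>b\<close> and \<open>b'\<close> are interchanged: an \<open>a2\<close> that can replace \<open>b'\<close>
  is not parallel to \<open>b\<close>, hence not to \<open>a'\<close>.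
  The third element \<open>e\<close> ensures that two elements outside \<open>H\<close> are still present for the second exchange.
\<close>

lemma double_exchange:
  assumes J: "J \<in> \<B>" and b: "b \<in> J - H" "b' \<in> J - H" "e \<in> J - H" "b \<noteq> b'" "b \<noteq> e" "b' \<noteq> e"
    and X: "X \<subseteq> H" "card X = r" "X' \<subseteq> H" "card X' = r"
  shows "\<exists>c c' a a'. c \<in> J - H \<and> c' \<in> J - H \<and> c \<noteq> c' \<and> a \<in> X - J \<and> a' \<in> X' - J \<and> a \<noteq> a' \<and>
     insert a (J - {c}) \<in> \<B> \<and> insert a' (J - {c'}) \<in> \<B> \<and> insert a (insert a' (J - {c, c'})) \<in> \<B>"
proof -
  define K where "K = J - {b, b'}"
  have K: "J = insert b (insert b' K)" "b \<notin> K" "b' \<notin> K" "e \<in> K" "J - {b} = insert b' K" "J - {b'} = insert b K"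
    "J - {b, b'} = K" "J - {b', b} = K"
    using b by (auto simp: K_def)
  obtain a where a: "a \<in> X" "a \<notin> J" "insert a (insert b' K) \<in> \<B>"
    using basis_exchange_relaxed[OF J _ _ _ _ _ X(1,2), of b e] b unfolding K(5) by blast
  have an: "a \<noteq> b" "a \<noteq> b'" "a \<notin> K" "a \<in> H" using a K X by auto
  have D: "b' \<in> insert a (insert b' K)" "e \<in> insert a (insert b' K)" using K by auto
  have Db: "insert a (insert b' K) - {b'} = insert a K" using an K by auto
  obtain a' where a': "a' \<in> X'" "a' \<notin> insert a (insert b' K)" "insert a' (insert a K) \<in> \<B>"
    using basis_exchange_relaxed[OF a(3) D b(6) _ _ X(3,4)] b unfolding Db by blast
  have a'n: "a' \<noteq> b" "a' \<noteq> b'" "a' \<notin> K" "a' \<noteq> a" using a' X b by auto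
  then have a'J: "a' \<notin> J" using K by auto
  show ?thesis
  proof (cases "insert a' (insert b K) \<in> \<B>")
    case True
    then show ?thesis using a a' a'J a'n b K
      by (intro exI[of _ b] exI[of _ b'] exI[of _ a] exI[of _ a']) (simp add: insert_commute)
  next
    case False
    have "a \<in> insert a' (insert a K)" "a \<notin> J" using a by auto
    from exchange[OF a'(3) J this]
    obtain y where y: "y \<in> J - insert a' (insert a K)" "insert y (insert a' (insert a K) - {a}) \<in> \<B>" by blast
    have "insert a' (insert a K) - {a} = insert a' K" using an a'n by auto
    moreover have "y = b \<or> y = b'" using y(1) K(1) by blast
    ultimately have L: "insert a' (insert b' K) \<in> \<B>"
      using y(2) False by (metis insert_commute)
    obtain a2 where a2: "a2 \<in> X" "a2 \<notin> J" "insert a2 (insert b K) \<in> \<B>"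
      using basis_exchange_relaxed[OF J _ _ _ _ _ X(1,2), of b' e] b unfolding K(6) by blast
    have a2n: "a2 \<noteq> b" "a2 \<noteq> b'" "a2 \<notin> K" "a2 \<noteq> a'" using a2 K False by auto
    have "b' \<in> insert a' (insert b' K)" "b' \<notin> insert a2 (insert b K)" using b a2n K by auto
    from exchange[OF L a2(3) this]
    obtain z where z: "z \<in> insert a2 (insert b K) - insert a' (insert b' K)"
      "insert z (insert a' (insert b' K) - {b'}) \<in> \<B>" by blast
    have "insert a' (insert b' K) - {b'} = insert a' K" using a'n K by auto
    moreover have "z = a2 \<or> z = b" using z(1) by blast
    ultimately have "insert a2 (insert a' K) \<in> \<B>"
      using z(2) False by (metis insert_commute)
    then show ?thesis using a2 a2n a' a'J b K L
      by (intro exI[of _ b'] exI[of _ b] exI[of _ a2] exI[of _ a']) (simp add: insert_commute)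
  qed
qed

lemma reduced_commute_below:
  assumes I: "finite I" and F: "reducible I f i j a b" and F': "reducible I f i' j' a' b'"
    and G: "reducible I (reduced f i j a b) i' j' a' b'"
    and G': "reducible I (reduced f i' j' a' b') i j a b"
    and eq: "reduced (reduced f i j a b) i' j' a' b' = reduced (reduced f i' j' a' b') i j a b"
  shows "(below I (n_inside I f))\<^sup>*\<^sup>* (reduced f i j a b) (reduced f i' j' a' b')"
proof -
  note n = reducible_n_inside[OF I F] reducible_n_inside[OF I F'] reducible_n_inside[OF I G] reducible_n_inside[OF I G']
  have "below I (n_inside I f) (reduced f i j a b) (reduced (reduced f i j a b) i' j' a' b')"
    unfolding below_def using n reducible_exch[OF G] by simp
  moreover have "below I (n_inside I f) (reduced (reduced f i j a b) i' j' a' b') (reduced f i' j' a' b')"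
    unfolding below_def eq using n exch_sym[OF reducible_exch[OF G']] by simp
  ultimately show ?thesis by simp
qed

end

text \<open>
  The assumption \<open>star\<close> is the condition on \<open>M\<close>, for families on two or three of the given positions.
\<close>

locale locally_connected = stressed +
  fixes I :: "nat set"
  assumes finite_I: "finite I"
    and star: "\<And>K f g h. K \<subseteq> I \<Longrightarrow> card K \<in> {2, 3} \<Longrightarrow> exch relaxed K f g \<Longrightarrow> exch relaxed K g h \<Longrightarrow>
      \<forall>k\<in>K. f k \<in> \<B> \<and> h k \<in> \<B> \<Longrightarrow> (exch \<B> K)\<^sup>*\<^sup>* f h"
begin

text \<open>
  The step from one reduction back to \<open>f\<close> and on to the other is a sequence of length two on the positions
  \<open>i\<close>, \<open>j\<close>, \<open>j'\<close>, at which both reductions have members of \<open>\<B>\<close> only. This is where \<open>star\<close> is used.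
\<close>

lemma reduced_same:
  assumes 1: "reducible I f i j a b" and 2: "reducible I f i j' a' b'"
  shows "(below I (n_inside I f))\<^sup>*\<^sup>* (reduced f i j a b) (reduced f i j' a' b')"
proof -
  define K where "K = {i, j, j'}"
  have ne: "i \<noteq> j" "i \<noteq> j'" using reducible_neq[OF 1] reducible_neq[OF 2] by simp_all
  have mem: "i \<in> I" "j \<in> I" "j' \<in> I" using 1 2 unfolding reducible_def by simp_all
  have K: "K \<subseteq> I" "card K \<in> {2, 3}"
    unfolding K_def using ne mem by (simp_all add: card_insert_if)
  have K1: "reducible K f i j a b" and K2: "reducible K f i j' a' b'"
    using 1 2 unfolding K_def reducible_def by simp_all
  have "\<forall>k\<in>K. reduced f i j a b k \<in> \<B> \<and> reduced f i j' a' b' k \<in> \<B>"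
    unfolding reduced_def K_def
    using 1 2 ne reducible_basis[OF 1] reducible_basis[OF 2] unfolding reducible_def by auto
  from star[OF K exch_sym[OF reducible_exch[OF K1]] reducible_exch[OF K2] this]
  have "(exch \<B> I)\<^sup>*\<^sup>* (reduced f i j a b) (reduced f i j' a' b')"
    using exch_rtranclp_mono[OF subset_refl K(1)] by blast
  then show ?thesis using bases_below[OF finite_I, of _ _ "n_inside I f"] reducible_n_inside[OF finite_I 1] by (metis lessI)
qed

lemma reduced_connected_disjoint:
  assumes 1: "reducible I f i j a b" and 2: "reducible I f i' j' a' b'" and ne: "i \<noteq> i'" "j \<noteq> j'"
  shows "(below I (n_inside I f))\<^sup>*\<^sup>* (reduced f i j a b) (reduced f i' j' a' b')"
proof -
  have ne': "i \<noteq> j'" "i' \<noteq> j" using 1 2 basis_out by (auto simp: reducible_def)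
  note neq = ne ne' reducible_neq[OF 1] reducible_neq[OF 2]
  have at: "reduced f i j a b i' = f i'" "reduced f i j a b j' = f j'"
    "reduced f i' j' a' b' i = f i" "reduced f i' j' a' b' j = f j"
    using neq by (simp_all add: reduced_def)
  show ?thesis
  proof (rule reduced_commute_below[OF finite_I 1 2])
    show "reducible I (reduced f i j a b) i' j' a' b'" using 2 unfolding reducible_def at .
    show "reducible I (reduced f i' j' a' b') i j a b" using 1 unfolding reducible_def at .
    show "reduced (reduced f i j a b) i' j' a' b' = reduced (reduced f i' j' a' b') i j a b"
      using neq by (intro ext) (simp add: reduced_def)
  qed
qed

text \<open>
  The difficult case is that of two new bases reduced by means of the same set \<open>f j\<close>. If there is
  another heavy set, the first reduction is replaced by one that uses it. Otherwise \<open>f j\<close> has at least three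
  outside elements by counting, and the two reductions are replaced by the commuting ones of \<open>double_exchange\<close>.
\<close>

lemma reduced_connected:
  assumes val: "\<forall>k\<in>I. f k \<in> relaxed" and w: "card I \<le> n_outside I f"
    and 1: "reducible I f i j a b" and 2: "reducible I f i' j' a' b'"
  shows "(below I (n_inside I f))\<^sup>*\<^sup>* (reduced f i j a b) (reduced f i' j' a' b')"
proof (cases "i = i'")
  case True
  then show ?thesis using reduced_same 1 2 by blast
next
  case ii: False
  have i: "i \<in> I" "i' \<in> I" "j \<in> I" "f i \<subseteq> H" "f i' \<subseteq> H" "f j \<in> \<B>"
    using 1 2 by (auto simp: reducible_def)
  have ji: "j \<noteq> i" "j \<noteq> i'" using i basis_out by blast+
  show ?thesis
  proof (cases "j = j'")
    case False
    then show ?thesis using reduced_connected_disjoint 1 2 ii by blast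
  next
    case jj: True
    show ?thesis
    proof (cases "\<exists>l\<in>I. l \<noteq> j \<and> heavy (f l)")
      case True
      then obtain l c d where l: "l \<noteq> j" "reducible I f i l c d"
        using reducible_exists[OF val i(1,4)] by blast
      show ?thesis
        using rtranclp_trans[OF reduced_same[OF 1 l(2)] reduced_connected_disjoint[OF l(2) 2 ii]] l(1) jj
        by blast
    next
      case False
      have le: "card (f k - H) \<le> of_bool (k \<noteq> i \<and> k \<noteq> i')" if "k \<in> I - {j}" for k
      proof (cases "k = i \<or> k = i'")
        case True
        then have "f k - H = {}" using i by blast
        then show ?thesis by (metis card.empty le0)
      next
        case ki: False
        have "f k \<in> relaxed" "\<not> heavy (f k)" using val False that by blast+
        then have "card (f k - H) \<le> 1" using not_heavy relaxed_finite by blast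
        with ki show ?thesis by simp
      qed
      have "n_outside I f = card (f j - H) + (\<Sum>k\<in>I - {j}. card (f k - H))"
        unfolding n_outside_def using finite_I i(3) by (rule sum.remove)
      also have "\<dots> \<le> card (f j - H) + (\<Sum>k\<in>I - {j}. of_bool (k \<noteq> i \<and> k \<noteq> i'))"
        using le by (intro add_left_mono sum_mono)
      also have "(\<Sum>k\<in>I - {j}. of_bool (k \<noteq> i \<and> k \<noteq> i')) = card (I - {j, i, i'})"
        using finite_I by (simp add: Int_def set_diff_eq)
      also have "\<dots> = card I - 3"
        using ji ii i finite_I by (subst card_Diff_subset) auto
      finally have "card I \<le> card (f j - H) + (card I - 3)" using w by linarith
      moreover have "card {j, i, i'} \<le> card I" using i finite_I by (intro card_mono) auto
      ultimately have "3 \<le> card (f j - H)" using ji ii by simp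
      then obtain B where "B \<subseteq> f j - H" "card B = 3"
        by (meson obtain_subset_with_card_n)
      then obtain c1 c2 c3 where c: "c1 \<in> f j - H" "c2 \<in> f j - H" "c3 \<in> f j - H" "c1 \<noteq> c2" "c1 \<noteq> c3" "c2 \<noteq> c3"
        by (auto simp: card_3_iff)
      have cr: "card (f i) = r" "card (f i') = r" using i val relaxed_card by blast+
      from double_exchange[OF i(6) c i(4) cr(1) i(5) cr(2)]
      obtain d d' x x' where d: "d \<in> f j - H" "d' \<in> f j - H" "d \<noteq> d'" "x \<in> f i - f j" "x' \<in> f i' - f j" "x \<noteq> x'"
        "insert x (f j - {d}) \<in> \<B>" "insert x' (f j - {d'}) \<in> \<B>" "insert x (insert x' (f j - {d, d'})) \<in> \<B>"
        by blast
      have x: "x \<noteq> d'" "x' \<noteq> d" using d by auto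
      have sets: "insert x' (insert x (f j - {d}) - {d'}) = insert x (insert x' (f j - {d, d'}))"
        "insert x (insert x' (f j - {d'}) - {d}) = insert x (insert x' (f j - {d, d'}))"
        using x by auto
      have R: "reducible I f i j x d" "reducible I f i' j x' d'"
        using d i cr by (simp_all add: reducible_def)
      have at: "reduced f i j x d i' = f i'" "reduced f i j x d j = insert x (f j - {d})"
        "reduced f i' j x' d' i = f i" "reduced f i' j x' d' j = insert x' (f j - {d'})"
        using ji ii by (simp_all add: reduced_def)
      have "(below I (n_inside I f))\<^sup>*\<^sup>* (reduced f i j x d) (reduced f i' j x' d')"
      proof (rule reduced_commute_below[OF finite_I R])
        show "reducible I (reduced f i j x d) i' j x' d'"
          unfolding reducible_def at sets using d i cr by simp
        show "reducible I (reduced f i' j x' d') i j x d"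
          unfolding reducible_def at sets using d i cr by simp
        show "reduced (reduced f i j x d) i' j x' d' = reduced (reduced f i' j x' d') i j x d"
          unfolding reduced_def[of "reduced f i j x d"] reduced_def[of "reduced f i' j x' d'"] at sets
          using ji ii by (intro ext) (simp add: reduced_def)
      qed
      from rtranclp_trans[OF rtranclp_trans[OF reduced_same[OF 1 R(1)] this] reduced_same[OF R(2) 2[folded jj]]]
      show ?thesis unfolding jj .
    qed
  qed
qed

section \<open>Removing the new bases from a sequence\<close>

text \<open>
  The induction along the path keeps, for a family \<open>g\<close> with the maximal number \<open>k\<close> of new bases, that all of its
  reductions have been reached from below instead of \<open>g\<close> itself.
\<close>

lemma lower_peaks:
  assumes k: "0 < k" and path: "(below I (Suc k))\<^sup>*\<^sup>* f g"
    and val: "\<forall>l\<in>I. f l \<in> relaxed" and w: "card I \<le> n_outside I f" and nf: "n_inside I f < k"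
  shows "(\<forall>l\<in>I. g l \<in> relaxed) \<and> card I \<le> n_outside I g \<and>
     (n_inside I g < k \<longrightarrow> (below I k)\<^sup>*\<^sup>* f g) \<and>
     (n_inside I g = k \<longrightarrow> (\<forall>i j a b. reducible I g i j a b \<longrightarrow> (below I k)\<^sup>*\<^sup>* f (reduced g i j a b)))"
  using path
proof induction
  case base
  then show ?case using val w nf by simp
next
  case (step g h)
  have gh: "exch relaxed I g h" and n: "n_inside I g \<le> k" "n_inside I h \<le> k"
    using step(2) by (auto simp: below_def)
  have gval: "\<forall>l\<in>I. g l \<in> relaxed" and gw: "card I \<le> n_outside I g" using step.IH by blast+
  have hval: "\<forall>l\<in>I. h l \<in> relaxed" using exch_members[OF r_into_rtranclp[of "exch relaxed I", OF gh] gval] .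
  have hw: "card I \<le> n_outside I h" using exch_n_outside[OF finite_I gh] gw by simp
  consider "n_inside I g < k" "n_inside I h < k" | "n_inside I g < k" "n_inside I h = k"
    | "n_inside I g = k" "n_inside I h < k" | "n_inside I g = k" "n_inside I h = k" using n by linarith
  then show ?case
  proof cases
    case 1
    have "below I k g h" using gh 1 by (simp add: below_def)
    moreover have "(below I k)\<^sup>*\<^sup>* f g" using step.IH 1(1) by blast
    ultimately have "(below I k)\<^sup>*\<^sup>* f h" by (meson rtranclp.rtrancl_into_rtrancl)
    with hval hw 1(2) show ?thesis by simp
  next
    case 2
    then obtain i j a b where r: "reducible I h i j a b" "g = reduced h i j a b"
      using decreasing_exch_reduced[OF finite_I exch_sym[OF gh]] by auto
    have fg: "(below I k)\<^sup>*\<^sup>* f g" using step.IH 2(1) by blast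
    have "(below I k)\<^sup>*\<^sup>* g (reduced h i' j' a' b')" if "reducible I h i' j' a' b'" for i' j' a' b'
      using reduced_connected[OF hval hw r(1) that] 2 unfolding r(2) by simp
    then have "(below I k)\<^sup>*\<^sup>* f (reduced h i' j' a' b')" if "reducible I h i' j' a' b'" for i' j' a' b'
      using rtranclp_trans[OF fg] that by blast
    with hval hw 2(2) show ?thesis by simp
  next
    case 3
    then obtain i j a b where r: "reducible I g i j a b" "h = reduced g i j a b"
      using decreasing_exch_reduced[OF finite_I gh] by auto
    then have "(below I k)\<^sup>*\<^sup>* f h" using step.IH 3 by blast
    then show ?thesis using hval hw 3 by simp
  next
    case 4
    then have "linked I g h"
      using linked_plateau[OF finite_I gval gw gh] k by simp
    then obtain i j a b i' j' a' b' where r: "reducible I g i j a b" "reducible I h i' j' a' b'"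
      "(below I k)\<^sup>*\<^sup>* (reduced g i j a b) (reduced h i' j' a' b')"
      unfolding linked_def 4 by blast
    have "(below I k)\<^sup>*\<^sup>* f (reduced g i j a b)" using step.IH 4 r(1) by blast
    then have fh: "(below I k)\<^sup>*\<^sup>* f (reduced h i' j' a' b')" using r(3) by (rule rtranclp_trans)
    have "(below I k)\<^sup>*\<^sup>* (reduced h i' j' a' b') (reduced h i2 j2 a2 b2)"
      if "reducible I h i2 j2 a2 b2" for i2 j2 a2 b2
      using reduced_connected[OF hval hw r(2) that] 4 by simp
    then have "(below I k)\<^sup>*\<^sup>* f (reduced h i2 j2 a2 b2)" if "reducible I h i2 j2 a2 b2" for i2 j2 a2 b2
      using rtranclp_trans[OF fh] that by blast
    with hval hw 4(2) show ?thesis by simp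
  qed
qed

text \<open>
  At the lowest level no new basis is left, so all sets taking part in the exchanges belong to \<open>\<B>\<close>.
\<close>

lemma bases_connected:
  assumes path: "(exch relaxed I)\<^sup>*\<^sup>* f g" and bases: "\<forall>k\<in>I. f k \<in> \<B>" "\<forall>k\<in>I. g k \<in> \<B>"
  shows "(exch \<B> I)\<^sup>*\<^sup>* f g"
proof -
  have val: "\<forall>k\<in>I. f k \<in> relaxed" using bases bases_relaxed by blast
  have new0: "n_inside I f = 0" "n_inside I g = 0" using bases basis_out by (auto simp: n_inside_def)
  have "card (f k - H) \<ge> 1" if "k \<in> I" for k
    using that bases basis_out[of "f k"] relaxed_finite[of "f k"] val by (auto simp: Suc_le_eq card_gt_0_iff)
  then have "(\<Sum>k\<in>I. 1) \<le> n_outside I f" unfolding n_outside_def by (intro sum_mono)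
  then have w: "card I \<le> n_outside I f" by simp
  have "n_inside I h \<le> card I" for h
  proof -
    have "n_inside I h \<le> (\<Sum>k\<in>I. 1)" unfolding n_inside_def by (intro sum_mono) simp
    then show ?thesis by simp
  qed
  then have "exch relaxed I f g \<Longrightarrow> below I (Suc (card I)) f g" for f g
    by (simp add: below_def le_imp_less_Suc)
  with path have start: "(below I (Suc (card I)))\<^sup>*\<^sup>* f g"
    by (rule mono_rtranclp[rule_format, rotated])
  have "(below I (Suc k))\<^sup>*\<^sup>* f g \<Longrightarrow> (below I 1)\<^sup>*\<^sup>* f g" for k
  proof (induction k)
    case (Suc k)
    then have "(below I (Suc k))\<^sup>*\<^sup>* f g"
      using lower_peaks[OF _ Suc.prems val w] new0 by simp
    then show ?case using Suc.IH by blast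
  qed simp
  with start have low: "(below I 1)\<^sup>*\<^sup>* f g" by blast
  have "exch \<B> I f g" if "below I 1 f g" for f g
  proof -
    have n: "n_inside I f = 0" "n_inside I g = 0" and fg: "exch relaxed I f g"
      using that by (simp_all add: below_def)
    have B: "h k \<in> \<B>" if "k \<in> I" "h k \<in> relaxed" "n_inside I h = 0" for h k
    proof -
      have "\<not> h k \<subseteq> H" using finite_I that(1,3) by (auto simp: n_inside_def)
      then show ?thesis using relaxed_basis that(2) by blast
    qed
    obtain p q where pq: "p \<in> I" "q \<in> I" "p \<noteq> q" "{f p, f q, g p, g q} \<subseteq> relaxed"
      "exchanged (f p) (f q) (g p) (g q)" "\<forall>k. k \<noteq> p \<longrightarrow> k \<noteq> q \<longrightarrow> g k = f k"
      using fg unfolding exch_def by blast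
    have "{f p, f q, g p, g q} \<subseteq> \<B>" using B[OF pq(1)] B[OF pq(2)] n pq(4) by simp
    with pq show ?thesis unfolding exch_def by blast
  qed
  with low show ?thesis by (rule mono_rtranclp[rule_format, rotated])
qed

end

section \<open>Tuples of bases as families\<close>

text \<open>
  The value outside the range of the list has to be fixed, because an exchange of families leaves all other
  indices unchanged.
\<close>

definition fam :: "'a set list \<Rightarrow> nat \<Rightarrow> 'a set" where
  "fam Bs k = (if k < length Bs then Bs ! k else {})"

lemma fam_map: "\<forall>k\<ge>n. f k = {} \<Longrightarrow> fam (map f [0..<n]) = f"
  by (auto simp: fam_def fun_eq_iff)

lemma map_fam: "length Bs = n \<Longrightarrow> map (fam Bs) [0..<n] = Bs"
  by (auto simp: fam_def intro: nth_equalityI)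

lemma symmetric_exchange_exchanged:
  "symmetric_exchange N (A, B) (A', B') \<longleftrightarrow> {A, B, A', B'} \<subseteq> bases N \<and> exchanged A B A' B'"
proof -
  have "(A \<union> {b}) - {a} = insert b (A - {a}) \<and> (B \<union> {a}) - {b} = insert a (B - {b})"
    if "a \<in> A - B" "b \<in> B - A" for a b
    using that by auto
  then have "(\<exists>a\<in>A - B. \<exists>b\<in>B - A. A' = (A \<union> {b}) - {a} \<and> B' = (B \<union> {a}) - {b} \<and> A' \<in> bases N \<and> B' \<in> bases N)
    \<longleftrightarrow> (\<exists>a\<in>A - B. \<exists>b\<in>B - A. A' = insert b (A - {a}) \<and> B' = insert a (B - {b}) \<and> A' \<in> bases N \<and> B' \<in> bases N)"
    by (intro bex_cong refl) metis
  then show ?thesis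
    unfolding symmetric_exchange_def exchanged_def by auto
qed

lemma exchange_step_exch:
  assumes "exchange_step N n Bs Cs" "length Bs = n" "length Cs = n"
  shows "exch (bases N) {..<n} (fam Bs) (fam Cs)"
proof -
  obtain i j where ij: "i < n" "j < n" "i \<noteq> j"
    and sym: "symmetric_exchange N (Bs ! i, Bs ! j) (Cs ! i, Cs ! j)"
    and off: "\<forall>k<n. k \<noteq> i \<and> k \<noteq> j \<longrightarrow> Cs ! k = Bs ! k"
    using assms(1) unfolding exchange_step_def by blast
  have at: "fam Bs i = Bs ! i" "fam Bs j = Bs ! j" "fam Cs i = Cs ! i" "fam Cs j = Cs ! j"
    using ij assms(2,3) by (simp_all add: fam_def)
  have "{fam Bs i, fam Bs j, fam Cs i, fam Cs j} \<subseteq> bases N"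
    "exchanged (fam Bs i) (fam Bs j) (fam Cs i) (fam Cs j)"
    unfolding at using sym[unfolded symmetric_exchange_exchanged] by blast+
  moreover have "\<forall>k. k \<noteq> i \<longrightarrow> k \<noteq> j \<longrightarrow> fam Cs k = fam Bs k"
    using off assms(2,3) by (simp add: fam_def)
  moreover have "i \<in> {..<n}" "j \<in> {..<n}" using ij by simp_all
  ultimately show ?thesis unfolding exch_def using ij(3) by blast
qed

lemma exch_exchange_step:
  assumes "exch (bases N) (\<sigma> ` {..<n}) f g" "inj_on \<sigma> {..<n}"
  shows "exchange_step N n (map (f \<circ> \<sigma>) [0..<n]) (map (g \<circ> \<sigma>) [0..<n])"
proof -
  obtain p q where pq: "p \<in> \<sigma> ` {..<n}" "q \<in> \<sigma> ` {..<n}" "p \<noteq> q" "{f p, f q, g p, g q} \<subseteq> bases N"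
    "exchanged (f p) (f q) (g p) (g q)" and off: "\<forall>k. k \<noteq> p \<longrightarrow> k \<noteq> q \<longrightarrow> g k = f k"
    by (rule exch_pairE[OF assms(1)])
  obtain i j where ij: "i < n" "p = \<sigma> i" "j < n" "q = \<sigma> j" using pq(1,2) by blast
  have "g (\<sigma> k) = f (\<sigma> k)" if "k < n" "k \<noteq> i" "k \<noteq> j" for k
    using off assms(2) that ij by (metis inj_onD lessThan_iff)
  moreover have "symmetric_exchange N (f p, f q) (g p, g q)"
    unfolding symmetric_exchange_exchanged using pq(4,5) by blast
  moreover have "i \<noteq> j" using pq(3) ij by blast
  ultimately show ?thesis
    unfolding exchange_step_def using ij
    by (intro exI[of _ i] conjI exI[of _ j]) simp_all
qed

lemma exchange_sequence_exch:
  assumes "exchange_sequence N n l F Bs Cs"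
  shows "(exch (bases N) {..<n})\<^sup>*\<^sup>* (fam Bs) (fam Cs)"
proof -
  have len: "length (F t) = n" if "t \<le> l" for t
    using assms that by (auto simp: exchange_sequence_def basis_tuples_def)
  have "t \<le> l \<Longrightarrow> (exch (bases N) {..<n})\<^sup>*\<^sup>* (fam (F 0)) (fam (F t))" for t
  proof (induction t)
    case (Suc t)
    have "exchange_step N n (F t) (F (Suc t))"
      using assms Suc.prems unfolding exchange_sequence_def
      by (metis diff_Suc_1 zero_less_Suc)
    then have "exch (bases N) {..<n} (fam (F t)) (fam (F (Suc t)))"
      by (rule exchange_step_exch) (use len Suc.prems in auto)
    then show ?case using Suc by (simp add: rtranclp.rtrancl_into_rtrancl)
  qed simp
  from this[of l] show ?thesis using assms by (simp add: exchange_sequence_def)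
qed

lemma exch_exchange_sequence:
  assumes "(exch (bases N) {..<n})\<^sup>*\<^sup>* f g" "\<forall>k<n. f k \<in> bases N"
  shows "\<exists>l F. exchange_sequence N n l F (map f [0..<n]) (map g [0..<n])"
  using assms(1)
proof induction
  case base
  have "exchange_sequence N n 0 (\<lambda>_. map f [0..<n]) (map f [0..<n]) (map f [0..<n])"
    using assms(2) by (auto simp: exchange_sequence_def basis_tuples_def)
  then show ?case by blast
next
  case (step g h)
  then obtain l F where F: "exchange_sequence N n l F (map f [0..<n]) (map g [0..<n])" by blast
  have "(exch (bases N) {..<n})\<^sup>*\<^sup>* f h" using step(1,2) by simp
  then have h: "map h [0..<n] \<in> basis_tuples N n"
    using exch_members[of "bases N" "{..<n}" f h] assms(2) by (auto simp: basis_tuples_def)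
  have s: "exchange_step N n (map g [0..<n]) (map h [0..<n])"
    using exch_exchange_step[of N id n g h] step(2) by simp
  have "exchange_sequence N n (Suc l) (F(Suc l := map h [0..<n])) (map f [0..<n]) (map h [0..<n])"
    using F h s unfolding exchange_sequence_def by (auto simp: le_Suc_eq)
  then show ?case by blast
qed

lemma count_multiset_union:
  assumes "\<forall>B\<in>set Bs. finite B" "length Bs = n"
  shows "count (multiset_union Bs) x = occ {..<n} (fam Bs) x"
proof -
  have "multiset_union Bs = (\<Sum>k<n. mset_set (Bs ! k))"
    unfolding multiset_union_def using assms(2) by (simp add: sum_list_sum_nth atLeast0LessThan)
  then have "count (multiset_union Bs) x = (\<Sum>k<n. count (mset_set (Bs ! k)) x)"
    by (simp add: count_sum)
  also have "\<dots> = occ {..<n} (fam Bs) x"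
    unfolding occ_def fam_def using assms by (intro sum.cong) (auto simp: count_mset_set')
  finally show ?thesis .
qed

lemma White_conjecture_fam:
  fixes N :: "'a basis_system"
  assumes fin: "\<forall>B\<in>bases N. finite B"
  shows "White_conjecture N \<longleftrightarrow> (\<forall>n::nat. 1 \<le> n \<longrightarrow> (\<forall>f g.
     (\<forall>k<n. f k \<in> bases N) \<longrightarrow> (\<forall>k<n. g k \<in> bases N) \<longrightarrow> (\<forall>k\<ge>n. f k = {}) \<longrightarrow> (\<forall>k\<ge>n. g k = {}) \<longrightarrow>
     (\<forall>x. occ {..<n} f x = occ {..<n} g x) \<longrightarrow> (exch (bases N) {..<n})\<^sup>*\<^sup>* f g))"
    (is "_ \<longleftrightarrow> ?fam")
proof
  assume W: "White_conjecture N"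
  show ?fam
  proof (intro allI impI)
    fix n :: nat and f g :: "nat \<Rightarrow> 'a set"
    assume n: "1 \<le> n" and f: "\<forall>k<n. f k \<in> bases N" and g: "\<forall>k<n. g k \<in> bases N"
      and off: "\<forall>k\<ge>n. f k = {}" "\<forall>k\<ge>n. g k = {}" and occ: "\<forall>x. occ {..<n} f x = occ {..<n} g x"
    let ?f = "map f [0..<n]" and ?g = "map g [0..<n]"
    have t: "?f \<in> basis_tuples N n" "?g \<in> basis_tuples N n" using f g by (auto simp: basis_tuples_def)
    have "count (multiset_union ?f) x = count (multiset_union ?g) x" for x
    proof -
      have "\<forall>B\<in>set ?f. finite B" "\<forall>B\<in>set ?g. finite B" using t fin by (auto simp: basis_tuples_def)
      then show ?thesis
        using count_multiset_union[of ?f n x] count_multiset_union[of ?g n x] occ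
        by (simp add: fam_map[OF off(1)] fam_map[OF off(2)])
    qed
    then have "multiset_union ?f = multiset_union ?g" by (rule multiset_eqI)
    then obtain l F where "exchange_sequence N n l F ?f ?g"
      using W n t unfolding White_conjecture_def by blast
    from exchange_sequence_exch[OF this] show "(exch (bases N) {..<n})\<^sup>*\<^sup>* f g"
      by (simp add: fam_map off)
  qed
next
  assume fam: ?fam
  show "White_conjecture N"
    unfolding White_conjecture_def
  proof (intro allI impI ballI)
    fix n :: nat and Bs Cs
    assume n: "1 \<le> n" and t: "Bs \<in> basis_tuples N n" "Cs \<in> basis_tuples N n"
      and eq: "multiset_union Bs = multiset_union Cs"
    have len: "length Bs = n" "length Cs = n" using t by (auto simp: basis_tuples_def)
    have B: "\<forall>k<n. fam Bs k \<in> bases N" "\<forall>k<n. fam Cs k \<in> bases N"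
      using t by (auto simp: basis_tuples_def fam_def)
    have "occ {..<n} (fam Bs) x = occ {..<n} (fam Cs) x" for x
    proof -
      have "\<forall>B\<in>set Bs. finite B" "\<forall>B\<in>set Cs. finite B" using t fin by (auto simp: basis_tuples_def)
      then show ?thesis
        using count_multiset_union[of Bs n x] count_multiset_union[of Cs n x] len eq by simp
    qed
    moreover have "\<forall>k\<ge>n. fam Bs k = {}" "\<forall>k\<ge>n. fam Cs k = {}" using len by (simp_all add: fam_def)
    ultimately have "(exch (bases N) {..<n})\<^sup>*\<^sup>* (fam Bs) (fam Cs)" using fam n B by blast
    from exch_exchange_sequence[OF this B(1)] show "\<exists>l F. exchange_sequence N n l F Bs Cs"
      by (simp add: map_fam len)
  qed
qed

text \<open>
  This lifts a sequence for tuples of length two or three, as supplied by the condition on the matroid, to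
  arbitrary positions \<open>K\<close> of a longer tuple, whose other entries are those of \<open>h\<close>.
\<close>

lemma exch_transport:
  fixes h :: "'i \<Rightarrow> 'a set"
  assumes \<sigma>: "bij_betw \<sigma> {..<m} K" and path: "(exch \<F> {..<m})\<^sup>*\<^sup>* u w"
  defines "plug \<equiv> \<lambda>u k. if k \<in> K then u (inv_into {..<m} \<sigma> k) else h k"
  shows "(exch \<F> K)\<^sup>*\<^sup>* (plug u) (plug w)"
  using path
proof induction
  case (step v w)
  obtain p q where pq: "p < m" "q < m" "p \<noteq> q" "{v p, v q, w p, w q} \<subseteq> \<F>"
    "exchanged (v p) (v q) (w p) (w q)" and off: "\<forall>k. k \<noteq> p \<longrightarrow> k \<noteq> q \<longrightarrow> w k = v k"
    using step(2) unfolding exch_def by auto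
  have K: "\<sigma> p \<in> K" "\<sigma> q \<in> K" "\<sigma> p \<noteq> \<sigma> q"
    using \<sigma> pq(1-3) by (auto simp: bij_betw_def inj_on_def)
  have inv: "inv_into {..<m} \<sigma> (\<sigma> i) = i" if "i < m" for i
    using \<sigma> that by (simp add: bij_betw_inv_into_left)
  have at: "plug u (\<sigma> i) = u i" if "i < m" for u i
    using that inv \<sigma> by (auto simp: plug_def bij_betw_def)
  have "plug w k = plug v k" if "k \<noteq> \<sigma> p" "k \<noteq> \<sigma> q" for k
  proof (cases "k \<in> K")
    case True
    then have "\<sigma> (inv_into {..<m} \<sigma> k) = k" using \<sigma> by (simp add: bij_betw_inv_into_right)
    then have "inv_into {..<m} \<sigma> k \<noteq> p" "inv_into {..<m} \<sigma> k \<noteq> q" using that by auto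
    then show ?thesis using off True by (simp add: plug_def)
  qed (simp add: plug_def)
  then have "exch \<F> K (plug v) (plug w)"
    unfolding exch_def using K pq by (intro bexI[of _ "\<sigma> p"] bexI[of _ "\<sigma> q"]) (simp_all add: at)
  with step.IH show ?case by simp
qed simp

lemma condition_star_exch:
  fixes f g h :: "nat \<Rightarrow> 'a set"
  assumes star: "condition_star M H" and K: "finite K" "card K \<in> {2, 3}"
    and fg: "exch (bases (relaxation M H)) K f g" and gh: "exch (bases (relaxation M H)) K g h"
    and bases: "\<forall>k\<in>K. f k \<in> bases M \<and> h k \<in> bases M"
  shows "(exch (bases M) K)\<^sup>*\<^sup>* f h"
proof -
  let ?R = "relaxation M H"
  define m where "m = card K"
  obtain \<sigma> where \<sigma>: "bij_betw \<sigma> {..<m} K"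
    using ex_bij_betw_nat_finite[OF K(1)] unfolding m_def atLeast0LessThan by blast
  then have \<sigma>': "inj_on \<sigma> {..<m}" "\<sigma> ` {..<m} = K" by (auto simp: bij_betw_def)
  define lst where "lst u = map (u \<circ> \<sigma>) [0..<m]" for u :: "nat \<Rightarrow> 'a set"
  have MR: "bases M \<subseteq> bases ?R" by (auto simp: relaxation_def)
  have fR: "\<forall>k\<in>K. f k \<in> bases ?R" and hR: "\<forall>k\<in>K. h k \<in> bases ?R" using bases MR by blast+
  have gR: "\<forall>k\<in>K. g k \<in> bases ?R"
    using exch_members[OF r_into_rtranclp[of "exch (bases ?R) K", OF fg] fR] .
  have tuple: "lst u \<in> basis_tuples N m" if "\<forall>k\<in>K. u k \<in> bases N" for u N
    using that \<sigma>'(2) by (auto simp: lst_def basis_tuples_def)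
  have s: "exchange_step ?R m (lst f) (lst g)" "exchange_step ?R m (lst g) (lst h)"
    using exch_exchange_step[of ?R \<sigma> m] fg gh \<sigma>' by (simp_all add: lst_def)
  define F where "F t = (if t = 0 then lst f else if t = 1 then lst g else lst h)" for t :: nat
  have "exchange_sequence ?R m 2 F (lst f) (lst h)"
    unfolding exchange_sequence_def
  proof (intro conjI allI impI)
    fix t :: nat assume t: "0 < t \<and> t \<le> 2"
    then have "t = 1 \<or> t = 2" by linarith
    then show "exchange_step ?R m (F (t - 1)) (F t)" using s by (auto simp: F_def)
  qed (use tuple fR gR hR in \<open>simp_all add: F_def\<close>)
  moreover have "lst f \<in> basis_tuples M m" "lst h \<in> basis_tuples M m" using tuple bases by blast+
  ultimately obtain l F' where "exchange_sequence M m l F' (lst f) (lst h)"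
    using star K(2) unfolding condition_star_def m_def by blast
  from exchange_sequence_exch[OF this]
  have "(exch (bases M) {..<m})\<^sup>*\<^sup>* (fam (lst f)) (fam (lst h))" .
  note path = exch_transport[OF \<sigma> this, of f]
  have inv: "inv_into {..<m} \<sigma> k < m" "\<sigma> (inv_into {..<m} \<sigma> k) = k" if "k \<in> K" for k
    using that \<sigma> \<sigma>'(2) inv_into_into[of k \<sigma> "{..<m}"] by (simp_all add: bij_betw_inv_into_right)
  have at: "fam (lst u) (inv_into {..<m} \<sigma> k) = u k" if "k \<in> K" for u k
    using inv[OF that] by (simp add: fam_def lst_def)
  have "(exch (bases ?R) K)\<^sup>*\<^sup>* f h" using fg gh by (meson converse_rtranclp_into_rtranclp r_into_rtranclp)
  from exch_outside[OF this] have off: "h k = f k" if "k \<notin> K" for k using that by blast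
  have "(\<lambda>k. if k \<in> K then fam (lst f) (inv_into {..<m} \<sigma> k) else f k) = f"
    "(\<lambda>k. if k \<in> K then fam (lst h) (inv_into {..<m} \<sigma> k) else f k) = h"
    using at off by (auto simp: fun_eq_iff)
  then show ?thesis using path by simp
qed

section \<open>Matroids with a stressed hyperplane\<close>

lemma matroid_finite_basis: "matroid M \<Longrightarrow> B \<in> bases M \<Longrightarrow> finite B"
  using finite_subset by (auto simp: matroid_def)

lemma matroid_exchange:
  assumes "matroid M" "A \<in> bases M" "B \<in> bases M" "a \<in> A" "a \<notin> B"
  shows "\<exists>b\<in>B - A. insert b (A - {a}) \<in> bases M"
  using assms unfolding matroid_def by auto

text \<open>
  Exchanging elements of \<open>A\<close> outside \<open>B\<close> for elements of \<open>B\<close> moves \<open>A\<close> into \<open>B\<close> without changing its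
  size.
\<close>

lemma bases_card_le:
  assumes M: "matroid M" and B: "B \<in> bases M"
  shows "A \<in> bases M \<Longrightarrow> card A \<le> card B"
proof (induction "card (A - B)" arbitrary: A rule: less_induct)
  case less
  have fin: "finite A" using matroid_finite_basis[OF M less.prems] .
  show ?case
  proof (cases "A \<subseteq> B")
    case True
    then show ?thesis using matroid_finite_basis[OF M B] by (rule card_mono[rotated])
  next
    case False
    then obtain a where a: "a \<in> A" "a \<notin> B" by blast
    obtain b where b: "b \<in> B - A" "insert b (A - {a}) \<in> bases M"
      using matroid_exchange[OF M less.prems B a] by blast
    have "card (insert b (A - {a}) - B) < card (A - B)"
      using a b fin by (intro psubset_card_mono) auto
    from less.hyps[OF this b(2)] show ?thesis
      using a b fin card_Suc_Diff1[OF fin a(1)] by simp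
  qed
qed

lemma bases_card_eq: "matroid M \<Longrightarrow> A \<in> bases M \<Longrightarrow> B \<in> bases M \<Longrightarrow> card A = card B"
  using bases_card_le by (metis le_antisym)

lemma rank_of_facts:
  assumes M: "matroid M" and X: "X \<subseteq> ground M"
  shows rank_of_attained: "\<exists>I\<subseteq>X. indep M I \<and> card I = rank_of M X"
    and rank_of_ge: "\<And>I. I \<subseteq> X \<Longrightarrow> indep M I \<Longrightarrow> card I \<le> rank_of M X"
proof -
  let ?C = "card ` {I. I \<subseteq> X \<and> indep M I}"
  have "finite X" using M X finite_subset by (auto simp: matroid_def)
  then have fin: "finite ?C" by simp
  have "indep M {}" using M by (auto simp: matroid_def indep_def)
  then have "?C \<noteq> {}" by blast
  from Max_in[OF fin this] show "\<exists>I\<subseteq>X. indep M I \<and> card I = rank_of M X"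
    unfolding rank_of_def by auto
  show "card I \<le> rank_of M X" if "I \<subseteq> X" "indep M I" for I
    unfolding rank_of_def using fin that by (intro Max_ge) auto
qed

lemma matroid_rank_card:
  assumes M: "matroid M" and B: "B \<in> bases M"
  shows "card B = matroid_rank M"
proof (rule antisym)
  show "card B \<le> matroid_rank M"
    unfolding matroid_rank_def
    by (rule rank_of_ge[OF M subset_refl]) (use M B in \<open>auto simp: matroid_def indep_def\<close>)
  obtain I where I: "indep M I" "card I = matroid_rank M"
    using rank_of_attained[OF M subset_refl] unfolding matroid_rank_def by blast
  then obtain B' where B': "B' \<in> bases M" "I \<subseteq> B'" by (auto simp: indep_def)
  have "card I \<le> card B'" using B' matroid_finite_basis[OF M] by (intro card_mono) auto
  then show "matroid_rank M \<le> card B" using I bases_card_eq[OF M B'(1) B] by simp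
qed

text \<open>
  The set \<open>S\<close> is independent, being a proper subset of a circuit inside \<open>H\<close>, so some \<open>insert f S\<close> is a basis.
  Since \<open>H\<close> is a flat, there is also a basis inside \<open>insert e H\<close>. Exchanging \<open>f\<close> against
  that basis can only bring in \<open>e\<close>, because no basis lies inside \<open>H\<close>.
\<close>

lemma stressed_hyperplane_near_basis:
  assumes M: "matroid M" and r: "matroid_rank M = r"
    and H: "stressed_hyperplane M H" and big: "r \<le> card H"
    and S: "S \<subseteq> H" "Suc (card S) = r" and e: "e \<in> ground M" "e \<notin> H"
  shows "insert e S \<in> bases M"
proof -
  have HG: "H \<subseteq> ground M" and flat: "rank_of M H < rank_of M (insert e H)"
    and rk: "rank_of M H + 1 = r"
    and circ: "\<And>T. T \<subseteq> H \<Longrightarrow> card T = r \<Longrightarrow> circuit M T"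
    using H e r unfolding stressed_hyperplane_def hyperplane_def flat_def by auto
  have no: "\<not> B \<subseteq> H" if "B \<in> bases M" for B
    using circ[of B] matroid_rank_card[OF M that] r that unfolding circuit_def indep_def by blast
  have finH: "finite H" using M HG finite_subset by (auto simp: matroid_def)
  have finS: "finite S" using S finH finite_subset by blast
  have "S \<noteq> H" using S big by auto
  then obtain h where h: "h \<in> H" "h \<notin> S" using S by blast
  have "circuit M (insert h S)" using circ[of "insert h S"] h S finS by simp
  then have "indep M S" using h unfolding circuit_def by blast
  then obtain B where B: "B \<in> bases M" "S \<subseteq> B" by (auto simp: indep_def)
  have "card (B - S) = 1"
    using card_Diff_subset[OF finS B(2)] matroid_rank_card[OF M B(1)] r S by simp
  then obtain f where "B - S = {f}" by (auto simp: card_1_singleton_iff)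
  then have f: "B = insert f S" "f \<notin> S" using B(2) by auto
  have fH: "f \<notin> H" using no[OF B(1)] f S by blast
  obtain I where I: "I \<subseteq> insert e H" "indep M I" "card I = rank_of M (insert e H)"
    using rank_of_attained[OF M, of "insert e H"] HG e by blast
  obtain A where A: "A \<in> bases M" "I \<subseteq> A" using I(2) by (auto simp: indep_def)
  have "card A \<le> card I" using matroid_rank_card[OF M A(1)] r rk flat I(3) by linarith
  then have IA: "I = A" using A(2) matroid_finite_basis[OF M A(1)] by (metis card_seteq)
  show ?thesis
  proof (cases "f = e")
    case True
    then show ?thesis using B f by simp
  next
    case False
    then have "f \<notin> A" using I(1) IA fH by blast
    then obtain g where g: "g \<in> A - B" "insert g (B - {f}) \<in> bases M"
      using matroid_exchange[OF M B(1) A(1), of f] f by blast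
    have "B - {f} = S" using f by auto
    moreover have "g \<notin> H" using no[OF g(2)] S calculation by auto
    ultimately show ?thesis using g I(1) IA by auto
  qed
qed

lemma stressed_hyperplane_stressed:
  assumes M: "matroid M" and r: "matroid_rank M = r"
    and H: "stressed_hyperplane M H" and big: "r \<le> card H"
  shows "stressed (bases M) H (ground M) r"
proof
  show "finite (ground M)" "\<And>B. B \<in> bases M \<Longrightarrow> B \<subseteq> ground M" using M by (auto simp: matroid_def)
  show "H \<subseteq> ground M"
    using H unfolding stressed_hyperplane_def hyperplane_def flat_def by blast
  show "card B = r" if "B \<in> bases M" for B using matroid_rank_card[OF M that] r by simp
  then show "\<not> B \<subseteq> H" if "B \<in> bases M" for B
    using H r that unfolding stressed_hyperplane_def circuit_def indep_def by blast
  show "\<And>A B a. A \<in> bases M \<Longrightarrow> B \<in> bases M \<Longrightarrow> a \<in> A \<Longrightarrow> a \<notin> B \<Longrightarrow>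
      \<exists>b\<in>B - A. insert b (A - {a}) \<in> bases M"
    by (rule matroid_exchange[OF M])
  show "\<And>S e. S \<subseteq> H \<Longrightarrow> Suc (card S) = r \<Longrightarrow> e \<in> ground M \<Longrightarrow> e \<notin> H \<Longrightarrow> insert e S \<in> bases M"
    by (rule stressed_hyperplane_near_basis[OF assms])
qed

text \<open>
  For the second part, the condition on \<open>M\<close> holds on any two or three positions of a longer tuple, so
  the sequence provided by the relaxation can be replaced by one in \<open>M\<close>.
\<close>

theorem theorem1p7:
  fixes M :: "'a basis_system" and H :: "'a set" and r :: nat
  assumes "matroid M"
    and "matroid_rank M = r"
    and "stressed_hyperplane M H"
    and "card H \<ge> r"
  shows "(White_conjecture M \<longrightarrow> White_conjecture (relaxation M H)) \<and>
         (White_conjecture (relaxation M H) \<and> condition_star M H \<longrightarrow> White_conjecture M)"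
proof -
  let ?R = "relaxation M H"
  interpret stressed "bases M" H "ground M" r
    by (rule stressed_hyperplane_stressed[OF assms])
  have R: "bases ?R = relaxed" using assms(2) by (simp add: relaxation_def relaxed_def)
  have finM: "\<forall>B\<in>bases M. finite B" using bases_relaxed relaxed_finite by blast
  have finR: "\<forall>B\<in>bases ?R. finite B" using relaxed_finite R by blast
  have "White_conjecture ?R" if W: "White_conjecture M"
    unfolding White_conjecture_fam[OF finR] R
  proof (intro allI impI)
    fix n :: nat and f g :: "nat \<Rightarrow> 'a set"
    assume n: "1 \<le> n" and *: "\<forall>k<n. f k \<in> relaxed" "\<forall>k<n. g k \<in> relaxed"
      "\<forall>k\<ge>n. f k = {}" "\<forall>k\<ge>n. g k = {}" "\<forall>x. occ {..<n} f x = occ {..<n} g x"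
    show "(exch relaxed {..<n})\<^sup>*\<^sup>* f g"
    proof (rule relaxed_connected)
      fix f' g'
      assume "\<forall>k\<in>{..<n}. f' k \<in> bases M" "\<forall>k\<in>{..<n}. g' k \<in> bases M"
        "\<And>x. occ {..<n} f' x = occ {..<n} g' x" "\<forall>k. k \<notin> {..<n} \<longrightarrow> f' k = f k \<and> g' k = f k"
      then show "(exch (bases M) {..<n})\<^sup>*\<^sup>* f' g'"
        using W[unfolded White_conjecture_fam[OF finM]] n *(3) by simp
    qed (use * in simp_all)
  qed
  moreover have "White_conjecture M" if W: "White_conjecture ?R" and star: "condition_star M H"
    unfolding White_conjecture_fam[OF finM]
  proof (intro allI impI)
    fix n :: nat and f g :: "nat \<Rightarrow> 'a set"
    assume n: "1 \<le> n" and *: "\<forall>k<n. f k \<in> bases M" "\<forall>k<n. g k \<in> bases M"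
      "\<forall>k\<ge>n. f k = {}" "\<forall>k\<ge>n. g k = {}" "\<forall>x. occ {..<n} f x = occ {..<n} g x"
    interpret locally_connected "bases M" H "ground M" r "{..<n}"
    proof
      fix K f g h
      assume "K \<subseteq> {..<n}" "card K \<in> {2, 3}" "exch relaxed K f g" "exch relaxed K g h"
        "\<forall>k\<in>K. f k \<in> bases M \<and> h k \<in> bases M"
      then show "(exch (bases M) K)\<^sup>*\<^sup>* f h"
        using condition_star_exch[OF star, of K f g h] finite_subset unfolding R by blast
    qed simp
    have "\<forall>k<n. f k \<in> relaxed" "\<forall>k<n. g k \<in> relaxed" using * bases_relaxed by blast+
    then have "(exch relaxed {..<n})\<^sup>*\<^sup>* f g"
      using W[unfolded White_conjecture_fam[OF finR] R] n * by simp
    then show "(exch (bases M) {..<n})\<^sup>*\<^sup>* f g"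
      by (rule bases_connected) (use * in simp_all)
  qed
  ultimately show ?thesis by blast
qed

end
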